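(* Let $m$ be a fixed positive integer. Then, as $k\to\infty$ through prime numbers, $$\sum_{h=1}^{k-1} s(h,k)^{2m} = 2\,\frac{\zeta(2m)^2}{\zeta(4m)}\left(\frac{k}{12}\right)^{2m} + O\!\left(\left(k^{9/5}+k^{2m-1+\frac{1}{m+1}}\right)\log^3 k\right),$$ where $\zeta$ is the Riemann zeta function.
   Context: For a positive integer $k$ and an integer $h$, the Dedekind sum is $s(h,k)=\sum_{a=1}^{k}\left(\left(\frac{a}{k}\right)\right)\left(\left(\frac{ah}{k}\right)\right)$, where $((x)) = x-\lfloor x\rfloor-\tfrac12$ if $x\notin\mathbb{Z}$ and $((x))=0$ if $x\in\mathbb{Z}$. The implied constant in the $O$-term may depend on $m$. *)

theory Defs
  imports "HOL-Analysis.Analysis" "HOL-Computational_Algebra.Primes" "HOL-Library.Landau_Symbols"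
begin

definition sawtooth :: "real \<Rightarrow> real" where
  "sawtooth x = (if x \<in> \<int> then 0 else x - of_int \<lfloor>x\<rfloor> - 1 / 2)"

definition dedekind_sum :: "int \<Rightarrow> nat \<Rightarrow> real" where
  "dedekind_sum h k =
     (\<Sum>a=1..k. sawtooth (real a / real k) * sawtooth (real a * real_of_int h / real k))"

(* The Dirichlet series, which is the Riemann zeta function only for s > 1. *)
definition zeta :: "real \<Rightarrow> real" where
  "zeta s = (\<Sum>n. 1 / real (Suc n) powr s)"

end

theory Submission
  imports Defs "HOL-Number_Theory.Cong"
begin

text \<open>
  If \<open>h d \<equiv> \<plusminus>c (mod k)\<close> with small coprime \<open>c, d\<close>, Rademacher's three-term relation gives
  \<open>|s(h,k)| = |k/(12cd) + E|\<close>, where \<open>E\<close> is bounded apart from two Dedekind sums with the small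
  moduli \<open>c\<close> and \<open>d\<close>. By Dirichlet approximation every \<open>h\<close> has such a pair with \<open>c, d \<le> 2 sqrt k\<close>,
  and the pairs with \<open>2c\<^sup>2, 2d\<^sup>2 < k\<close> are unique up to the sign, which the even power removes. Hence the
  moment is \<open>2 \<Sum> (k/(12cd))\<^sup>2\<^sup>m\<close> over coprime pairs, and
  \<open>\<Sum> (cd)\<^sup>-\<^sup>2\<^sup>m = \<zeta>(2m)\<^sup>2/\<zeta>(4m)\<close>, up to an error controlled by \<open>|E| \<le> c + d\<close> and by the mean
  square of \<open>E\<close>. For the latter, if \<open>h/d\<close> is within \<open>1/e\<^sup>2\<close> of a reduced fraction of denominator
  \<open>e \<le> sqrt d\<close>, summing the sawtooth over blocks of length \<open>e\<close> gives \<open>s(h,d) = O(d/e)\<close>; so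
  \<open>\<Sum>\<^sub>h s(h,d)\<^sup>2 = O(d\<^sup>5\<^sup>/\<^sup>2)\<close>, and the mean square of \<open>E\<close> contributes \<open>O(k\<^sup>7\<^sup>/\<^sup>4)\<close>. The total error is
  \<open>O(k\<^sup>m\<^sup>+\<^sup>3\<^sup>/\<^sup>4 + k\<^sup>2\<^sup>m\<^sup>-\<^sup>1)\<close>.
\<close>

section \<open>Sawtooth sums over residues\<close>

lemma sum_periodic_affine:
  fixes f :: "int \<Rightarrow> real"
  assumes "N > 0" "coprime u N" and per: "\<And>x. f (x mod N) = f x"
  shows "(\<Sum>x\<in>{0..<N}. f (u * x + t)) = sum f {0..<N}"
proof -
  \<comment> \<open>Since \<open>u\<close> is a unit mod \<open>N\<close>, the map
    \<open>x \<mapsto> u * x + t\<close> permutes the residues; injectivity suffices because the set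
    is finite.\<close>
  have inj: "inj_on (\<lambda>x. (u * x + t) mod N) {0..<N}"
  proof (rule inj_onI)
    fix x y assume xy: "x \<in> {0..<N}" "y \<in> {0..<N}" "(u * x + t) mod N = (u * y + t) mod N"
    then have "[u * x = u * y] (mod N)"
      using cong_add_rcancel unfolding cong_def[symmetric] by blast
    then have "[x = y] (mod N)"
      using assms(2) cong_mult_lcancel by blast
    then show "x = y"
      using xy by (simp add: cong_def)
  qed
  have "(\<lambda>x. (u * x + t) mod N) ` {0..<N} = {0..<N}"
    by (rule card_subset_eq) (use assms(1) inj in \<open>auto simp: card_image\<close>)
  then have "bij_betw (\<lambda>x. (u * x + t) mod N) {0..<N} {0..<N}"
    using inj by (simp add: bij_betw_def)
  then have "sum f {0..<N} = (\<Sum>x\<in>{0..<N}. f ((u * x + t) mod N))"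
    by (rule sum.reindex_bij_betw[symmetric])
  then show ?thesis
    by (simp add: per)
qed

lemma sum_periodic_shift:
  fixes f :: "int \<Rightarrow> real"
  assumes "N > 0" and "\<And>x. f (x mod N) = f x"
  shows "(\<Sum>x\<in>{0..<N}. f (x + t)) = sum f {0..<N}"
  using sum_periodic_affine[of N 1 f t] assms by simp

lemma sum_int_blocks:
  fixes f :: "int \<Rightarrow> real"
  assumes "N \<ge> 0" "M \<ge> 0"
  shows "sum f {0..<N * M} = (\<Sum>j\<in>{0..<M}. \<Sum>x\<in>{0..<N}. f (x + N * j))"
  using assms(2)
proof (induction M rule: int_ge_induct)
  case base
  then show ?case by simp
next
  case (step M)
  have "{0..<N * (M + 1)} = {0..<N * M} \<union> {N * M..<N * M + N}"
  proof -
    have "0 \<le> N * M" using assms(1) step.hyps by simp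
    then show ?thesis using assms(1) unfolding distrib_left by auto
  qed
  then have "sum f {0..<N * (M + 1)} = sum f {0..<N * M} + sum f {N * M..<N * M + N}"
    by (simp add: sum.union_disjoint)
  also have "sum f {N * M..<N * M + N} = (\<Sum>x\<in>{0..<N}. f (x + N * M))"
    by (rule sum.reindex_bij_witness[of _ "\<lambda>x. x + N * M" "\<lambda>x. x - N * M"]) auto
  also have "{0..<M + 1} = insert M {0..<M}"
    using step.hyps by auto
  ultimately show ?case
    using step by simp
qed

lemma sum_periodic_blocks:
  fixes f :: "int \<Rightarrow> real"
  assumes "N > 0" "M \<ge> 0" and per: "\<And>x. f (x mod N) = f x"
  shows "sum f {0..<N * M} = of_int M * sum f {0..<N}"
proof -
  have "f (x + N * j) = f x" for x j
    using per[of "x + N * j"] per[of x] by simp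
  then show ?thesis
    using assms by (simp add: sum_int_blocks)
qed

section \<open>The sawtooth at rational arguments\<close>

definition saw :: "int \<Rightarrow> int \<Rightarrow> real" where
  "saw n q = sawtooth (of_int n / of_int q)"

lemma sawtooth_plus_int: "sawtooth (x + of_int n) = sawtooth x"
proof -
  have "x + of_int n \<in> \<int> \<longleftrightarrow> x \<in> \<int>"
    by (metis Ints_add Ints_diff Ints_of_int add_diff_cancel_right')
  then show ?thesis by (simp add: sawtooth_def)
qed

lemma saw_add_period: "q \<noteq> 0 \<Longrightarrow> saw (n + q * j) q = saw n q"
  using sawtooth_plus_int[of "of_int n / of_int q" j] by (simp add: saw_def add_divide_distrib)

lemma saw_mod: "q > 0 \<Longrightarrow> saw (n mod q) q = saw n q"
  using saw_add_period[of q "n mod q" "n div q"] by simp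

lemma saw_0 [simp]: "saw 0 q = 0"
  by (simp add: saw_def sawtooth_def)

lemma saw_small:
  assumes "0 < n" "n < q"
  shows "saw n q = of_int n / of_int q - 1 / 2"
proof -
  have *: "\<lfloor>real_of_int n / real_of_int q\<rfloor> = 0"
    using assms by (simp add: floor_eq_iff)
  have "real_of_int n / real_of_int q \<notin> \<int>"
  proof
    assume "real_of_int n / real_of_int q \<in> \<int>"
    then obtain z where "real_of_int n / real_of_int q = of_int z"
      by (elim Ints_cases)
    with * have "real_of_int n / real_of_int q = 0" by simp
    with assms show False by simp
  qed
  with * show ?thesis by (simp add: saw_def sawtooth_def)
qed

lemma saw_eq:
  assumes "q > 0"
  shows "saw n q = (if q dvd n then 0 else of_int (n mod q) / of_int q - 1 / 2)"
proof -
  have "saw n q = saw (n mod q) q" by (simp add: saw_mod assms)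
  moreover have "0 < n mod q" if "\<not> q dvd n"
    using that assms by (simp add: dvd_eq_mod_eq_0 order_less_le)
  ultimately show ?thesis
    using saw_small[of "n mod q" q] assms by auto
qed

lemma saw_minus:
  assumes "q > 0"
  shows "saw (- n) q = - saw n q"
proof -
  have "n mod q \<noteq> q"
    using assms by (metis less_irrefl pos_mod_bound)
  then show ?thesis
    using assms by (auto simp: saw_eq zmod_zminus1_eq_if dvd_eq_mod_eq_0 field_simps)
qed

text \<open>Moving \<open>x\<close> by a multiple of \<open>b\<close> moves \<open>a * x\<close> by
  a multiple of \<open>a * b\<close>. This supplies the periodicity needed to permute the terms of a
  sum along a progression.\<close>

lemma saw_linear_mod:
  assumes "a > 0" "b > 0"
  shows "saw (m + a * (x mod b)) (a * b) = saw (m + a * x) (a * b)"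
proof -
  have "a * x = a * (x mod b) + (a * b) * (x div b)"
    by (metis distrib_left mult.assoc mod_mult_div_eq)
  then have "m + a * x = (m + a * (x mod b)) + (a * b) * (x div b)"
    by simp
  then have "saw (m + a * x) (a * b) = saw ((m + a * (x mod b)) + (a * b) * (x div b)) (a * b)"
    by (rule arg_cong)
  also have "\<dots> = saw (m + a * (x mod b)) (a * b)"
    by (rule saw_add_period) (use assms in simp)
  finally show ?thesis ..
qed

lemma saw_scale: "t \<noteq> 0 \<Longrightarrow> saw (t * n) (t * q) = saw n q"
  by (simp add: saw_def)

lemma abs_saw_le: "q > 0 \<Longrightarrow> \<bar>saw n q\<bar> \<le> 1 / 2"
proof -
  assume q: "q > 0"
  then have "real_of_int (n mod q) < real_of_int q" "real_of_int (n mod q) \<ge> 0"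
    using pos_mod_bound[of q n] pos_mod_sign[of q n] by simp_all
  then have "\<bar>real_of_int (n mod q) / real_of_int q - 1 / 2\<bar> \<le> 1 / 2"
    using q by (simp add: abs_le_iff field_simps del: of_int_less_iff of_int_0_le_iff)
  then show ?thesis
    using q by (simp add: saw_eq)
qed

section \<open>Distribution relation and second moments of the sawtooth\<close>

lemma sum_int_upto: "n \<ge> 0 \<Longrightarrow> (\<Sum>i\<in>{0..<n}. real_of_int i) = of_int n * (of_int n - 1) / 2"
proof (induction n rule: int_ge_induct)
  case (step n)
  have "{0..<n + 1} = insert n {0..<n}" using step by auto
  then show ?case using step by (simp add: field_simps)
qed simp

text \<open>With \<open>y = m / (a * b)\<close> this is the multiplication formula of the first
  periodic Bernoulli function: the values ((y + i/b)) sum to ((b y)). Once \<open>m\<close> is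
  reduced modulo \<open>a\<close>, all arguments stay in the first period, where the sawtooth is
  explicit.\<close>

lemma sum_saw_distribution:
  assumes "a > 0" "b > 0"
  shows "(\<Sum>i\<in>{0..<b}. saw (m + a * i) (a * b)) = saw m a"
proof -
  define f where "f i = saw (m mod a + a * i) (a * b)" for i
  have per: "f (x mod b) = f x" for x
    using saw_linear_mod[OF assms] by (simp add: f_def)
  \<comment> \<open>The quotient \<open>m div a\<close> is absorbed as a shift of \<open>i\<close>,
    so \<open>m\<close> may be replaced by its remainder.\<close>
  have "saw (m + a * i) (a * b) = f (i + m div a)" for i
    by (simp add: f_def algebra_simps)
  then have "(\<Sum>i\<in>{0..<b}. saw (m + a * i) (a * b)) = sum f {0..<b}"
    using sum_periodic_shift[of b f] assms(2) per by simp
  also have "\<dots> = saw m a"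
  proof (cases "a dvd m")
    case True
    have "f 0 = 0" using True by (simp add: f_def)
    moreover have "{0..<b} = insert 0 {1..<b}" using assms by auto
    ultimately have "sum f {0..<b} = sum f {1..<b}" by simp
    also have "\<dots> = (\<Sum>i\<in>{1..<b}. of_int i / of_int b - 1 / 2)"
      using True assms by (intro sum.cong) (auto simp: f_def saw_scale saw_small)
    finally have 1: "sum f {0..<b} = (\<Sum>i\<in>{1..<b}. of_int i / of_int b - 1 / 2)" .
    \<comment> \<open>The reflection \<open>i \<mapsto> b - i\<close> pairs values of opposite
      sign.\<close>
    have 2: "(\<Sum>i\<in>{1..<b}. of_int i / of_int b - 1 / 2) = 
        (\<Sum>i\<in>{1..<b}. of_int (b - i) / of_int b - (1 / 2 :: real))"
      by (rule sum.reindex_bij_witness[of _ "\<lambda>i. b - i" "\<lambda>i. b - i"]) auto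
    have "(\<Sum>i\<in>{1..<b}. of_int i / of_int b - 1 / 2) +
        (\<Sum>i\<in>{1..<b}. of_int (b - i) / of_int b - (1 / 2 :: real)) = (\<Sum>i\<in>{1..<b}. 0)"
      unfolding sum.distrib[symmetric] using assms by (intro sum.cong) (auto simp: field_simps)
    with 2 have "(\<Sum>i\<in>{1..<b}. of_int i / of_int b - (1 / 2 :: real)) = 0" by simp
    with 1 True assms show ?thesis by (simp add: saw_eq)
  next
    case False
    then have r: "0 < m mod a" "m mod a < a"
      using assms pos_mod_sign[of a m] pos_mod_bound[of a m] by (auto simp: dvd_eq_mod_eq_0 order_less_le)
    \<comment> \<open>All arguments lie strictly between 0 and \<open>a * b\<close>, so no jump is
      met and the terms form an arithmetic progression.\<close>
    have "f i = of_int (m mod a) / (of_int a * of_int b) + of_int i / of_int b - 1 / 2"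
      if "i \<in> {0..<b}" for i
    proof -
      have "a * i + a \<le> a * b"
        using that assms by (metis atLeastLessThan_iff distrib_left mult.right_neutral mult_le_cancel_left_pos zless_imp_add1_zle)
      then have "m mod a + a * i < a * b" using r by linarith
      moreover have "0 < m mod a + a * i" using r that assms by (simp add: add_pos_nonneg)
      ultimately show ?thesis
        using assms by (simp add: f_def saw_small field_simps)
    qed
    then have "sum f {0..<b} = (\<Sum>i\<in>{0..<b}. of_int (m mod a) / (of_int a * of_int b) + of_int i / of_int b - 1 / 2)"
      by simp
    also have "\<dots> = of_int b * (of_int (m mod a) / (of_int a * of_int b)) - of_int b / 2
        + (\<Sum>i\<in>{0..<b}. of_int i) / of_int b"
      using assms by (simp add: sum.distrib sum_subtractf sum_divide_distrib)
    also have "\<dots> = of_int (m mod a) / of_int a - 1 / 2"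
      using assms by (simp add: sum_int_upto field_simps)
    finally show ?thesis
      using False assms by (simp add: saw_eq)
  qed
  finally show ?thesis .
qed

lemma sum_saw_distribution_coprime:
  assumes "a > 0" "b > 0" "coprime c b"
  shows "(\<Sum>i\<in>{0..<b}. saw (m + a * c * i) (a * b)) = saw m a"
  using sum_periodic_affine[of b c "\<lambda>i. saw (m + a * i) (a * b)" 0] saw_linear_mod[of a b m] assms
    sum_saw_distribution[of a b m]
  by (simp add: mult.assoc)

text \<open>Averaging over translates by a period of one factor leaves that factor alone and lets
  the distribution relation coarsen the other. Doing this once for each factor brings both down to
  modulus \<open>a\<close>.\<close>

lemma sum_saw_mult_saw:
  assumes "a > 0" "b > 0" "c > 0" "coprime b c"
  shows "(\<Sum>m\<in>{0..<a * b * c}. saw m (c * a) * saw m (a * b)) = (\<Sum>m\<in>{0..<a}. saw m a ^ 2)"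
proof -
  let ?N = "a * b * c"
  have N: "?N > 0" using assms by simp
  have p1: "saw (x mod ?N) (c * a) = saw x (c * a)" for x
    by (metis assms(1,3) dvd_triv_right mod_mod_cancel mult.assoc mult.commute mult_pos_pos saw_mod)
  have p2: "saw (x mod ?N) (a * b) = saw x (a * b)" for x
    by (metis assms(1,2) dvd_triv_left mod_mod_cancel mult_pos_pos saw_mod)
  have p3: "saw (x mod ?N) a = saw x a" for x
    by (metis assms(1) dvd_triv_left mod_mod_cancel mult.assoc saw_mod)
  \<comment> \<open>Translates by \<open>a * c * i\<close> preserve the factor of period
    \<open>c * a\<close>; since \<open>c\<close> is a unit mod \<open>b\<close>, they collapse the
    other factor from modulus \<open>a * b\<close> to modulus \<open>a\<close>.\<close>
  have "of_int b * (\<Sum>m\<in>{0..<?N}. saw m (c * a) * saw m (a * b))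
      = (\<Sum>i\<in>{0..<b}. \<Sum>m\<in>{0..<?N}. saw (m + a * c * i) (c * a) * saw (m + a * c * i) (a * b))"
    using assms(2) sum_periodic_shift[OF N, where f = "\<lambda>m. saw m (c * a) * saw m (a * b)"] p1 p2 by simp
  also have "\<dots> = (\<Sum>m\<in>{0..<?N}. \<Sum>i\<in>{0..<b}. saw m (c * a) * saw (m + a * c * i) (a * b))"
    using assms saw_add_period[of "c * a"] by (subst sum.swap) (simp add: mult.commute)
  also have "\<dots> = (\<Sum>m\<in>{0..<?N}. saw m (c * a) * saw m a)"
    unfolding sum_distrib_left[symmetric]
    using sum_saw_distribution_coprime[of a b c] assms by (simp add: coprime_commute)
  finally have 1: "of_int b * (\<Sum>m\<in>{0..<?N}. saw m (c * a) * saw m (a * b)) 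
      = (\<Sum>m\<in>{0..<?N}. saw m (c * a) * saw m a)" .
  \<comment> \<open>Translates by \<open>a * i\<close> now preserve \<open>saw m a\<close> and
    collapse the modulus \<open>c * a\<close>. The factors \<open>b\<close> and \<open>c\<close>
    picked up on the way cancel against the \<open>b * c\<close> periods in the range.\<close>
  have "of_int c * (\<Sum>m\<in>{0..<?N}. saw m (c * a) * saw m a)
      = (\<Sum>i\<in>{0..<c}. \<Sum>m\<in>{0..<?N}. saw (m + a * i) (c * a) * saw (m + a * i) a)"
    using assms(3) sum_periodic_shift[OF N, where f = "\<lambda>m. saw m (c * a) * saw m a"] p1 p3 by simp
  also have "\<dots> = (\<Sum>m\<in>{0..<?N}. \<Sum>i\<in>{0..<c}. saw (m + a * i) (a * c) * saw m a)"
    using assms saw_add_period[of a] by (subst sum.swap) (simp add: mult.commute)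
  also have "\<dots> = (\<Sum>m\<in>{0..<?N}. saw m a ^ 2)"
    unfolding sum_distrib_right[symmetric]
    using sum_saw_distribution[of a c] assms by (simp add: power2_eq_square)
  also have "\<dots> = of_int (b * c) * (\<Sum>m\<in>{0..<a}. saw m a ^ 2)"
    unfolding mult.assoc using assms by (intro sum_periodic_blocks) (simp_all add: saw_mod)
  finally show ?thesis
    using 1 assms by (simp add: field_simps)
qed

lemma sum_saw_squares:
  assumes "a > 0"
  shows "(\<Sum>m\<in>{0..<a}. saw m a ^ 2) = of_int a / 12 - 1 / 4 + 1 / (6 * of_int a)"
proof -
  \<comment> \<open>Here \<open>x\<close> is independent of \<open>n\<close>, so the induction moves
    the upper limit while the denominator stays fixed.\<close>
  have *: "(\<Sum>m\<in>{1..<n}. (of_int m * x - 1 / 2) ^ 2) =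
     (of_int n - 1) * of_int n * (2 * of_int n - 1) * x ^ 2 / 6
       - of_int n * (of_int n - 1) * x / 2 + (of_int n - 1) / 4"
    if "n > 0" for n and x :: real
    using that
  proof (induction n rule: int_gr_induct)
    case base
    then show ?case by simp
  next
    case (step n)
    have "{1..<n + 1} = insert n {1..<n}" using step by auto
    then show ?case using step by (simp add: field_simps power2_eq_square)
  qed
  have "{0..<a} = insert 0 {1..<a}" using assms by auto
  then have "(\<Sum>m\<in>{0..<a}. saw m a ^ 2) = (\<Sum>m\<in>{1..<a}. saw m a ^ 2)" by simp
  also have "\<dots> = (\<Sum>m\<in>{1..<a}. (of_int m * (1 / of_int a) - 1 / 2) ^ 2)"
    by (intro sum.cong) (auto simp: saw_small)
  also have "\<dots> = of_int a / 12 - 1 / 4 + 1 / (6 * of_int a)"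
    unfolding *[OF assms] using assms by (simp add: field_simps power2_eq_square)
  finally show ?thesis .
qed

section \<open>The three-term relation\<close>

text \<open>Rademacher's homogeneous Dedekind sum, with the modulus last;
  \<open>gen_dedekind 1 h k\<close> is the classical \<open>s(h,k)\<close>.\<close>

definition gen_dedekind :: "int \<Rightarrow> int \<Rightarrow> int \<Rightarrow> real" where
  "gen_dedekind b c a = (\<Sum>r\<in>{0..<a}. saw (b * r) a * saw (c * r) a)"

text \<open>A product rule for differences centred at the midpoints: by symmetry only terms with one
  or three differences survive. Midpoints are wanted because those of the ramps below are exact
  sawtooth values.\<close>

lemma prod3_diff_midpoint:
  fixes u v w u' v' w' :: real
  shows "u * v * w - u' * v' * w' =
      (u - u') * ((v + v') / 2) * ((w + w') / 2) + (v - v') * ((w + w') / 2) * ((u + u') / 2)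
      + (w - w') * ((u + u') / 2) * ((v + v') / 2) + (u - u') * (v - v') * (w - w') / 4"
  by (simp add: field_simps)

text \<open>
  The linear interpolation shifted by half a grid step: its two values around \<open>n\<close> average exactly to
  the sawtooth at \<open>n/q\<close>, including the value \<open>0\<close> at the jumps. Telescoping the product of the three
  ramps with periods \<open>bc\<close>, \<open>ca\<close>, \<open>ab\<close> over one period \<open>abc\<close> then yields the three-term relation.
\<close>

definition ramp :: "int \<Rightarrow> int \<Rightarrow> real" where
  "ramp n q = (of_int (n mod q) + 1 / 2) / of_int q - 1 / 2"

lemma mod_pred_cases:
  fixes n q :: int
  assumes "q > 0"
  shows "(n - 1) mod q = (if q dvd n then q - 1 else n mod q - 1)"
proof -
  have 1: "(n - 1) mod q = (n mod q - 1) mod q" by (simp add: mod_diff_left_eq)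
  show ?thesis
  proof (cases "q dvd n")
    case True
    then show ?thesis using 1 assms by (simp add: zmod_minus1)
  next
    case False
    moreover have "0 \<le> n mod q" "n mod q < q" using assms by simp_all
    ultimately have "(n mod q - 1) mod q = n mod q - 1"
      by (intro mod_pos_pos_trivial) (simp_all add: dvd_eq_mod_eq_0)
    then show ?thesis using 1 False by simp
  qed
qed

lemma ramp_diff:
  assumes "q > 0"
  shows "ramp n q - ramp (n - 1) q = 1 / of_int q - of_bool (q dvd n)"
proof (cases "q dvd n")
  case True
  then have "n mod q = 0" "(n - 1) mod q = q - 1" using mod_pred_cases[OF assms, of n] by simp_all
  with True assms show ?thesis by (simp add: ramp_def field_simps)
next
  case False
  then have "(n - 1) mod q = n mod q - 1" using mod_pred_cases[OF assms, of n] by simp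
  with False assms show ?thesis by (simp add: ramp_def add_divide_distrib diff_divide_distrib)
qed

lemma ramp_mean:
  assumes "q > 0"
  shows "(ramp n q + ramp (n - 1) q) / 2 = saw n q"
proof (cases "q dvd n")
  case True
  then have 1: "n mod q = 0" "(n - 1) mod q = q - 1" using mod_pred_cases[OF assms, of n] by simp_all
  show ?thesis unfolding ramp_def 1 using True assms by (simp add: saw_eq field_simps)
next
  case False
  then have "(n - 1) mod q = n mod q - 1" using mod_pred_cases[OF assms, of n] by simp
  with False assms show ?thesis by (simp add: ramp_def saw_eq add_divide_distrib diff_divide_distrib)
qed

lemma sum_multiples:
  fixes f :: "int \<Rightarrow> real"
  assumes "q > 0" "a > 0"
  shows "(\<Sum>m\<in>{0..<q * a}. of_bool (q dvd m) * f m) = (\<Sum>r\<in>{0..<a}. f (q * r))"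
proof -
  have "(\<Sum>m\<in>{0..<q * a}. of_bool (q dvd m) * f m) = (\<Sum>m\<in>{m\<in>{0..<q * a}. q dvd m}. f m)"
    unfolding sum.inter_filter[OF finite_atLeastLessThan_int] by (intro sum.cong) auto
  also have "\<dots> = (\<Sum>r\<in>{0..<a}. f (q * r))"
    by (rule sum.reindex_bij_witness[of _ "\<lambda>r. q * r" "\<lambda>m. m div q"])
      (use assms in \<open>auto simp: zero_le_mult_iff\<close>)
  finally show ?thesis .
qed

text \<open>At a jump \<open>m = b * c * r\<close> the common factors \<open>c\<close> and
  \<open>b\<close> cancel in the two sawtooth arguments, leaving the modulus \<open>a\<close> in
  both.\<close>

lemma gen_dedekind_as_jump_sum:
  assumes "a > 0" "b > 0" "c > 0"
  shows "(\<Sum>m\<in>{0..<a * b * c}. of_bool (b * c dvd m) * (saw m (c * a) * saw m (a * b))) = gen_dedekind b c a"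
proof -
  have "(\<Sum>m\<in>{0..<b * c * a}. of_bool (b * c dvd m) * (saw m (c * a) * saw m (a * b)))
      = (\<Sum>r\<in>{0..<a}. saw (b * c * r) (c * a) * saw (b * c * r) (a * b))"
    by (rule sum_multiples) (use assms in auto)
  moreover have "saw (b * c * r) (c * a) = saw (b * r) a" "saw (b * c * r) (a * b) = saw (c * r) a" for r
    using saw_scale[of c "b * r" a] saw_scale[of b "c * r" a] assms by (simp_all add: mult_ac)
  ultimately show ?thesis
    by (simp add: gen_dedekind_def mult_ac)
qed

lemma sum_of_bool_dvd:
  assumes "q > 0" "a > 0"
  shows "(\<Sum>m\<in>{0..<q * a}. of_bool (q dvd m)) = (of_int a :: real)"
  using sum_multiples[OF assms, of "\<lambda>_. 1"] assms by simp

text \<open>The differences of a product of three ramps sum to zero over a full period. In the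
  product rule the slopes yield second moments of the sawtooth, the jumps yield the three Dedekind
  sums, and the term with three differences is elementary.\<close>

lemma gen_dedekind_three_term:
  assumes pos: "a > 0" "b > 0" "c > 0" and cop: "coprime a b" "coprime b c" "coprime c a"
  shows "gen_dedekind b c a + gen_dedekind c a b + gen_dedekind a b c =
    (of_int a / (of_int b * of_int c) + of_int b / (of_int c * of_int a) + of_int c / (of_int a * of_int b)) / 12 - 1 / 4"
proof -
  let ?N = "a * b * c"
  let ?I = "{0..<?N}"
  define U V W where UVW: "U m = saw m (b * c)" "V m = saw m (c * a)" "W m = saw m (a * b)" for m
  \<comment> \<open>Each ramp increment is a slope (\<open>\<alpha>\<close>, \<open>\<beta>\<close>,
    \<open>\<gamma>\<close>) minus a jump indicator (\<open>i\<close>, \<open>j\<close>,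
    \<open>k\<close>).\<close>
  define i j k :: "int \<Rightarrow> real" where ijk: "i m = of_bool (b * c dvd m)" "j m = of_bool (c * a dvd m)" "k m = of_bool (a * b dvd m)" for m
  define \<alpha> \<beta> \<gamma> :: real where abg: "\<alpha> = 1 / of_int (b * c)" "\<beta> = 1 / of_int (c * a)" "\<gamma> = 1 / of_int (a * b)"
  define F where "F m = ramp m (b * c) * ramp m (c * a) * ramp m (a * b)" for m
  have N: "?N > 0" using pos by simp
  have perF: "F (x mod ?N) = F x" for x
  proof -
    have "x mod ?N mod (b * c) = x mod (b * c)" "x mod ?N mod (c * a) = x mod (c * a)"
        "x mod ?N mod (a * b) = x mod (a * b)"
      by (rule mod_mod_cancel; simp add: mult_ac)+
    then show ?thesis by (simp add: F_def ramp_def)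
  qed
  have "F m - F (m - 1) = (\<alpha> - i m) * V m * W m + (\<beta> - j m) * W m * U m + (\<gamma> - k m) * U m * V m
      + (\<alpha> - i m) * (\<beta> - j m) * (\<gamma> - k m) / 4" for m
    unfolding F_def UVW ijk abg prod3_diff_midpoint[of "ramp m (b * c)"]
    using pos by (simp only: ramp_mean ramp_diff mult_pos_pos)
  then have "(\<Sum>m\<in>?I. F m) - (\<Sum>m\<in>?I. F (m - 1)) = (\<Sum>m\<in>?I. (\<alpha> - i m) * V m * W m
      + (\<beta> - j m) * W m * U m + (\<gamma> - k m) * U m * V m
      + (\<alpha> - i m) * (\<beta> - j m) * (\<gamma> - k m) / 4)"
    by (simp add: sum_subtractf[symmetric])
  moreover have "(\<Sum>m\<in>?I. F (m - 1)) = (\<Sum>m\<in>?I. F m)"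
    using sum_periodic_shift[OF N, of F "-1"] perF by simp
  ultimately have "0 = (\<Sum>m\<in>?I. (\<alpha> - i m) * V m * W m
      + (\<beta> - j m) * W m * U m + (\<gamma> - k m) * U m * V m
      + (\<alpha> - i m) * (\<beta> - j m) * (\<gamma> - k m) / 4)"
    by simp
  also have "\<dots> = (\<Sum>m\<in>?I. \<alpha> * (V m * W m) - i m * (V m * W m) + (\<beta> * (W m * U m) - j m * (W m * U m))
      + (\<gamma> * (U m * V m) - k m * (U m * V m)) + (\<alpha> - i m) * (\<beta> - j m) * (\<gamma> - k m) / 4)"
    by (intro sum.cong refl) (simp add: left_diff_distrib mult.assoc)
  also have "\<dots> = (\<alpha> * (\<Sum>m\<in>?I. V m * W m) - (\<Sum>m\<in>?I. i m * (V m * W m)))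
     + (\<beta> * (\<Sum>m\<in>?I. W m * U m) - (\<Sum>m\<in>?I. j m * (W m * U m)))
     + (\<gamma> * (\<Sum>m\<in>?I. U m * V m) - (\<Sum>m\<in>?I. k m * (U m * V m)))
     + (\<Sum>m\<in>?I. (\<alpha> - i m) * (\<beta> - j m) * (\<gamma> - k m)) / 4"
    unfolding sum.distrib sum_subtractf sum_distrib_left sum_divide_distrib ..
  finally have 0: "0 = \<dots>" .
  have 1: "(\<Sum>m\<in>?I. V m * W m) = of_int a / 12 - 1 / 4 + 1 / (6 * of_int a)"
    using sum_saw_mult_saw[of a b c] sum_saw_squares[of a] pos cop by (simp add: UVW)
  have 2: "(\<Sum>m\<in>?I. W m * U m) = of_int b / 12 - 1 / 4 + 1 / (6 * of_int b)"
    using sum_saw_mult_saw[of b c a] sum_saw_squares[of b] pos cop by (simp add: UVW mult_ac)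
  have 3: "(\<Sum>m\<in>?I. U m * V m) = of_int c / 12 - 1 / 4 + 1 / (6 * of_int c)"
    using sum_saw_mult_saw[of c a b] sum_saw_squares[of c] pos cop by (simp add: UVW mult_ac)
  have 4: "(\<Sum>m\<in>?I. i m * (V m * W m)) = gen_dedekind b c a"
    using gen_dedekind_as_jump_sum[of a b c] pos by (simp add: UVW ijk)
  have 5: "(\<Sum>m\<in>?I. j m * (W m * U m)) = gen_dedekind c a b"
    using gen_dedekind_as_jump_sum[of b c a] pos by (simp add: UVW ijk mult_ac)
  have 6: "(\<Sum>m\<in>?I. k m * (U m * V m)) = gen_dedekind a b c"
    using gen_dedekind_as_jump_sum[of c a b] pos by (simp add: UVW ijk mult_ac)
  define l :: "int \<Rightarrow> real" where "l m = of_bool (?N dvd m)" for m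
  \<comment> \<open>By pairwise coprimality a common multiple of two of \<open>b * c\<close>,
    \<open>c * a\<close>, \<open>a * b\<close> is a multiple of \<open>a * b * c\<close>. Products
    of different indicators therefore reduce to \<open>l\<close>, and the triple product becomes
    linear in the indicators.\<close>
  have ij: "i m * j m = l m" "j m * k m = l m" "k m * i m = l m" "i m * l m = l m" for m
  proof -
    have x: "x * y dvd m \<Longrightarrow> y * z dvd m \<Longrightarrow> x * y * z dvd m" if "coprime x z" "y > 0" for x y z :: int
    proof -
      assume *: "x * y dvd m" "y * z dvd m"
      then obtain t where t: "m = y * t"
        by (metis dvd_def dvd_mult_left)
      have "x dvd t" "z dvd t"
        using * that unfolding t by (simp_all add: mult.commute[of x y])
      then have "x * z dvd t" using that divides_mult by blast
      then show "x * y * z dvd m" unfolding t by (simp add: mult_ac)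
    qed
    have "b * c dvd ?N" "c * a dvd ?N" "a * b dvd ?N"
      by (simp_all add: mult_ac)
    then have g: "b * c dvd m \<and> c * a dvd m \<and> a * b dvd m" if "?N dvd m"
      using that dvd_trans by blast
    have d: "?N dvd m" if "b * c dvd m" "c * a dvd m"
      using x[of b a c] that cop pos by (simp add: coprime_commute mult_ac)
    have e: "?N dvd m" if "c * a dvd m" "a * b dvd m"
      using x[of c b a] that cop pos by (simp add: coprime_commute mult_ac)
    have f: "?N dvd m" if "a * b dvd m" "b * c dvd m"
      using x[of a c b] that cop pos by (simp add: coprime_commute mult_ac)
    show "i m * j m = l m" "j m * k m = l m" "k m * i m = l m" "i m * l m = l m"
      unfolding ijk l_def of_bool_conj[symmetric] using d e f g
      by (intro arg_cong[where f = of_bool]; blast)+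
  qed
  have s1: "sum i ?I = of_int a" "sum j ?I = of_int b" "sum k ?I = of_int c" "sum l ?I = 1"
    using sum_of_bool_dvd[of "b * c" a] sum_of_bool_dvd[of "c * a" b] sum_of_bool_dvd[of "a * b" c]
      sum_of_bool_dvd[of ?N 1] pos by (simp_all add: ijk l_def mult_ac)
  have "(\<alpha> - i m) * (\<beta> - j m) * (\<gamma> - k m) = \<alpha> * \<beta> * \<gamma> - \<alpha> * \<beta> * k m - \<beta> * \<gamma> * i m - \<gamma> * \<alpha> * j m
     + (\<alpha> + \<beta> + \<gamma> - 1) * l m" for m
  proof -
    have "(\<alpha> - i m) * (\<beta> - j m) * (\<gamma> - k m) = \<alpha> * \<beta> * \<gamma> - \<alpha> * \<beta> * k m - \<beta> * \<gamma> * i m - \<gamma> * \<alpha> * j m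
     + \<alpha> * (j m * k m) + \<beta> * (k m * i m) + \<gamma> * (i m * j m) - i m * (j m * k m)"
      by (simp add: algebra_simps)
    then show ?thesis
      unfolding ij by (simp add: algebra_simps)
  qed
  then have 7: "(\<Sum>m\<in>?I. (\<alpha> - i m) * (\<beta> - j m) * (\<gamma> - k m)) = of_int ?N * (\<alpha> * \<beta> * \<gamma>)
     - \<alpha> * \<beta> * sum k ?I - \<beta> * \<gamma> * sum i ?I - \<gamma> * \<alpha> * sum j ?I + (\<alpha> + \<beta> + \<gamma> - 1) * sum l ?I"
    using N by (simp add: sum.distrib sum_subtractf sum_distrib_left)
  have "gen_dedekind b c a + gen_dedekind c a b + gen_dedekind a b c =
     \<alpha> * (of_int a / 12 - 1 / 4 + 1 / (6 * of_int a)) + \<beta> * (of_int b / 12 - 1 / 4 + 1 / (6 * of_int b))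
     + \<gamma> * (of_int c / 12 - 1 / 4 + 1 / (6 * of_int c)) + (of_int ?N * (\<alpha> * \<beta> * \<gamma>)
     - \<alpha> * \<beta> * of_int c - \<beta> * \<gamma> * of_int a - \<gamma> * \<alpha> * of_int b + (\<alpha> + \<beta> + \<gamma> - 1)) / 4"
  proof -
    have *: "p + q + r = x + y + z + w" if "0 = (x - p) + (y - q) + (z - r) + w" for p q r x y z w :: real
      using that by linarith
    show ?thesis
      by (rule *) (use 0 in \<open>simp only: 1 2 3 4 5 6 7 s1 mult_1_right\<close>)
  qed
  also have "\<dots> = (of_int a / (of_int b * of_int c) + of_int b / (of_int c * of_int a) + of_int c / (of_int a * of_int b)) / 12 - 1 / 4"
  proof -
    \<comment> \<open>The mixed products are all multiples of \<open>\<nu>\<close> and add up to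
      \<open>3 * \<nu> / 6 + (\<nu> - 3 * \<nu>) / 4 = 0\<close>; the quarters of
      \<open>\<alpha>\<close>, \<open>\<beta>\<close>, \<open>\<gamma>\<close> cancel as well, which
      leaves the constant \<open>- 1 / 4\<close>.\<close>
    define \<nu> :: real where "\<nu> = 1 / (of_int a * of_int b * of_int c)"
    have "\<alpha> * (1 / (6 * of_int a)) = \<nu> / 6" "\<beta> * (1 / (6 * of_int b)) = \<nu> / 6" "\<gamma> * (1 / (6 * of_int c)) = \<nu> / 6"
      "of_int ?N * (\<alpha> * \<beta> * \<gamma>) = \<nu>" "\<alpha> * \<beta> * of_int c = \<nu>" "\<beta> * \<gamma> * of_int a = \<nu>" "\<gamma> * \<alpha> * of_int b = \<nu>"
      "of_int a / (of_int b * of_int c) = \<alpha> * of_int a" "of_int b / (of_int c * of_int a) = \<beta> * of_int b"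
      "of_int c / (of_int a * of_int b) = \<gamma> * of_int c"
      using pos by (simp_all add: abg \<nu>_def)
    note e = this
    show ?thesis
      unfolding distrib_left right_diff_distrib e by (simp add: field_simps)
  qed
  finally show ?thesis .
qed

section \<open>Symmetries of the sums and the classical case\<close>

lemma gen_dedekind_commute: "gen_dedekind b c a = gen_dedekind c b a"
  by (simp add: gen_dedekind_def mult.commute)

lemma saw_mult_mod: "a > 0 \<Longrightarrow> saw (b * (x mod a)) a = saw (b * x) a"
  by (metis mod_mult_right_eq saw_mod)

text \<open>The substitution \<open>r \<mapsto> u * r\<close> permutes the residues. This is what
  later allows \<open>h\<close> to be replaced by a quotient \<open>c / d\<close> of small
  numbers.\<close>

lemma gen_dedekind_mult:
  assumes "a > 0" "coprime u a"
  shows "gen_dedekind (u * b) (u * c) a = gen_dedekind b c a"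
  using sum_periodic_affine[of a u "\<lambda>r. saw (b * r) a * saw (c * r) a" 0] assms
  by (simp add: gen_dedekind_def saw_mult_mod mult_ac)

lemma gen_dedekind_mod: "a > 0 \<Longrightarrow> gen_dedekind b (c mod a) a = gen_dedekind b c a"
  using saw_mult_mod[of a _ c] by (simp add: gen_dedekind_def mult.commute[of _ "_ :: int"])

lemma gen_dedekind_minus: "a > 0 \<Longrightarrow> gen_dedekind b (- c) a = - gen_dedekind b c a"
  by (simp add: gen_dedekind_def saw_minus sum_negf)

lemma abs_gen_dedekind_le:
  assumes "a > 0"
  shows "\<bar>gen_dedekind b c a\<bar> \<le> of_int a / 4"
proof -
  have "\<bar>saw (b * r) a * saw (c * r) a\<bar> \<le> 1 / 4" for r
    using mult_mono[OF abs_saw_le[OF assms, of "b * r"] abs_saw_le[OF assms, of "c * r"]]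
    by (simp add: abs_mult)
  then have "\<bar>gen_dedekind b c a\<bar> \<le> (\<Sum>r\<in>{0..<a}. 1 / 4)"
    unfolding gen_dedekind_def by (intro order_trans[OF sum_abs] sum_mono)
  then show ?thesis using assms by simp
qed

lemma sum_int_eq_sum_nat: "(\<Sum>i\<in>{0..<int n}. f i) = (\<Sum>i<n. f (int i))"
  by (rule sum.reindex_bij_witness[of _ int nat]) auto

text \<open>The two ranges differ only in the end terms \<open>a = k\<close> and
  \<open>r = 0\<close>, and both vanish because the sawtooth is 0 at integers.\<close>

lemma dedekind_sum_eq_gen:
  assumes "k > 0"
  shows "dedekind_sum h k = gen_dedekind 1 h (int k)"
proof -
  have "saw (int k * h) (int k) = 0"
    using assms by (simp add: saw_eq)
  then have "dedekind_sum h k = (\<Sum>a\<in>{1..<k}. saw (int a) (int k) * saw (h * int a) (int k))"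
    unfolding dedekind_sum_def using assms
    by (subst sum.last_plus) (simp_all add: saw_def mult.commute)
  also have "\<dots> = (\<Sum>a\<in>{0..<k}. saw (int a) (int k) * saw (h * int a) (int k))"
    using assms by (simp add: sum.atLeast_Suc_lessThan)
  also have "\<dots> = gen_dedekind 1 h (int k)"
    by (simp add: gen_dedekind_def sum_int_eq_sum_nat atLeast0LessThan)
  finally show ?thesis .
qed

section \<open>Mean square over a modulus\<close>

lemma sum_floor_complete_residues:
  fixes z :: real
  assumes e: "e > 0" and "coprime j e"
  shows "(\<Sum>i\<in>{0..<e}. real_of_int \<lfloor>z + of_int (j * i) / of_int e\<rfloor>)
    = of_int \<lfloor>of_int e * z\<rfloor> + (of_int j - 1) * (of_int e - 1) / 2"
proof -
  define n where "n = \<lfloor>of_int e * z\<rfloor>"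
  \<comment> \<open>The floor equals \<open>(j * i + n) div e\<close> and is thus determined by a
    remainder; since \<open>j\<close> is a unit mod \<open>e\<close>, these remainders run through
    all residues together with \<open>i\<close>.\<close>
  have "real_of_int \<lfloor>z + of_int (j * i) / of_int e\<rfloor>
      = (of_int n + of_int j * of_int i - of_int ((j * i + n) mod e)) / of_int e" for i
  proof -
    have "\<lfloor>z + of_int (j * i) / of_int e\<rfloor> = \<lfloor>(of_int e * z + of_int (j * i)) / of_int e\<rfloor>"
      using e by (simp add: field_simps)
    also have "\<dots> = \<lfloor>of_int e * z + of_int (j * i)\<rfloor> div e"
      using e by (simp only: floor_divide_real_eq_div)
    also have "\<lfloor>of_int e * z + of_int (j * i)\<rfloor> = j * i + n"
      by (simp only: floor_add_int[symmetric] n_def add.commute)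
    finally have 1: "\<lfloor>z + of_int (j * i) / of_int e\<rfloor> = (j * i + n) div e" .
    have "real_of_int (j * i + n) = of_int e * of_int ((j * i + n) div e) + of_int ((j * i + n) mod e)"
      unfolding of_int_mult[symmetric] of_int_add[symmetric] by simp
    then show ?thesis
      unfolding 1 using e by (simp add: field_simps)
  qed
  then have "(\<Sum>i\<in>{0..<e}. real_of_int \<lfloor>z + of_int (j * i) / of_int e\<rfloor>)
      = (\<Sum>i\<in>{0..<e}. (of_int n + of_int j * of_int i - of_int ((j * i + n) mod e)) / of_int e)"
    by simp
  also have "\<dots> = (of_int e * of_int n + of_int j * (\<Sum>i\<in>{0..<e}. of_int i)
      - (\<Sum>i\<in>{0..<e}. of_int ((j * i + n) mod e))) / of_int e"
    using e by (simp add: sum_divide_distrib[symmetric] sum_subtractf sum.distrib sum_distrib_left)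
  also have "(\<Sum>i\<in>{0..<e}. real_of_int ((j * i + n) mod e)) = (\<Sum>i\<in>{0..<e}. of_int (i mod e))"
    using sum_periodic_affine[of e j "\<lambda>i. of_int (i mod e)" n] assms by simp
  also have "\<dots> = (\<Sum>i\<in>{0..<e}. of_int i)"
    by (intro sum.cong) auto
  also have "(of_int e * of_int n + of_int j * (\<Sum>i\<in>{0..<e}. of_int i) - (\<Sum>i\<in>{0..<e}. of_int i)) / of_int e
      = of_int n + (of_int j - 1) * (of_int e - 1) / (2 :: real)"
    using e by (simp add: sum_int_upto field_simps)
  finally show ?thesis
    by (simp only: n_def)
qed

text \<open>For \<open>0 \<le> i < e\<close> the point \<open>i * \<theta>\<close> is within
  \<open>1 / e\<close> of \<open>i * j / e\<close>, and the points \<open>x + i * j / e\<close> are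
  equally spaced modulo 1, so the centred fractional parts nearly cancel.\<close>

lemma abs_sum_frac_block_le:
  fixes x \<theta> :: real
  assumes e: "e > 0" and cop: "coprime j e" and th: "\<bar>\<theta> - of_int j / of_int e\<bar> \<le> 1 / of_int e ^ 2"
  shows "\<bar>\<Sum>i\<in>{0..<e}. frac (x + of_int i * \<theta>) - 1 / 2\<bar> \<le> 2"
proof -
  define E J where "E = real_of_int e" and "J = real_of_int j"
  have E: "E \<ge> 1" using e by (simp add: E_def)
  have bd: "\<bar>of_int i * \<theta> - of_int (j * i) / E\<bar> \<le> 1 / E" if "i \<in> {0..<e}" for i
  proof -
    have "\<bar>of_int i * \<theta> - of_int (j * i) / E\<bar> = of_int i * \<bar>\<theta> - J / E\<bar>"
    proof -
      have "of_int i * \<theta> - of_int (j * i) / E = of_int i * (\<theta> - J / E)"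
        by (simp add: J_def algebra_simps)
      then show ?thesis using that by (simp add: abs_mult)
    qed
    also have "\<dots> \<le> E * (1 / E ^ 2)"
      using that th by (intro mult_mono) (auto simp: E_def J_def)
    also have "\<dots> = 1 / E" using E by (simp add: power2_eq_square)
    finally show ?thesis .
  qed
  \<comment> \<open>Monotonicity of the floor sandwiches the sum between two exactly evaluable ones.\<close>
  let ?F = "\<Sum>i\<in>{0..<e}. real_of_int \<lfloor>x + of_int i * \<theta>\<rfloor>"
  have "?F \<le> (\<Sum>i\<in>{0..<e}. real_of_int \<lfloor>(x + 1 / E) + of_int (j * i) / of_int e\<rfloor>)"
    using bd by (intro sum_mono of_int_le_iff[THEN iffD2] floor_mono) (fastforce simp: abs_le_iff E_def)
  also have "\<dots> = of_int \<lfloor>E * (x + 1 / E)\<rfloor> + (J - 1) * (E - 1) / 2"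
    unfolding E_def J_def using sum_floor_complete_residues[OF e cop] .
  also have "\<dots> \<le> E * x + 1 + (J - 1) * (E - 1) / 2"
    using of_int_floor_le[of "E * (x + 1 / E)"] E by (simp add: distrib_left)
  finally have F1: "?F \<le> E * x + 1 + (J - 1) * (E - 1) / 2" .
  have "of_int \<lfloor>E * (x - 1 / E)\<rfloor> + (J - 1) * (E - 1) / 2
      = (\<Sum>i\<in>{0..<e}. real_of_int \<lfloor>(x - 1 / E) + of_int (j * i) / of_int e\<rfloor>)"
    unfolding E_def J_def using sum_floor_complete_residues[OF e cop, symmetric] .
  also have "\<dots> \<le> ?F"
    using bd by (intro sum_mono of_int_le_iff[THEN iffD2] floor_mono) (fastforce simp: abs_le_iff E_def)
  finally have "of_int \<lfloor>E * (x - 1 / E)\<rfloor> + (J - 1) * (E - 1) / 2 \<le> ?F" .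
  moreover have "E * x - 2 \<le> of_int \<lfloor>E * (x - 1 / E)\<rfloor>"
    using floor_correct[of "E * (x - 1 / E)"] E by (simp add: right_diff_distrib) linarith
  ultimately have F2: "E * x - 2 + (J - 1) * (E - 1) / 2 \<le> ?F" by linarith
  have "(\<Sum>i\<in>{0..<e}. frac (x + of_int i * \<theta>) - 1 / 2)
      = E * x + (\<Sum>i\<in>{0..<e}. of_int i) * \<theta> - ?F - E / 2"
    using e by (simp add: frac_def sum_subtractf sum.distrib sum_distrib_right E_def)
  \<comment> \<open>Replacing \<open>J / E\<close> by \<open>\<theta>\<close> costs a drift of size
    at most 1/2. With the two bounds on \<open>?F\<close> the total lies between
    \<open>- 1 - 1 / 2 - 1 / 2\<close> and \<open>2 - 1 / 2 + 1 / 2\<close>.\<close>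
  also have "\<dots> = E * x + (J - 1) * (E - 1) / 2 - ?F - 1 / 2 + (E - 1) * (E * \<theta> - J) / 2"
    using e by (simp add: sum_int_upto E_def field_simps)
  finally have S: "(\<Sum>i\<in>{0..<e}. frac (x + of_int i * \<theta>) - 1 / 2) = \<dots>" .
  have "\<bar>E * \<theta> - J\<bar> = E * \<bar>\<theta> - J / E\<bar>"
    using E by (simp add: abs_mult_pos[symmetric] abs_mult field_simps)
  also have "\<dots> \<le> E * (1 / E ^ 2)"
    using th E unfolding E_def J_def by (intro mult_left_mono) auto
  also have "\<dots> = 1 / E" using E by (simp add: power2_eq_square)
  finally have "\<bar>(E - 1) * (E * \<theta> - J)\<bar> \<le> (E - 1) * (1 / E)"
    unfolding abs_mult using E by (intro mult_mono) auto
  also have "\<dots> \<le> 1" using E by (simp add: field_simps)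
  finally have "\<bar>(E - 1) * (E * \<theta> - J)\<bar> \<le> 1" .
  with S F1 F2 show ?thesis by linarith
qed

text \<open>Each of the \<open>n div e\<close> full blocks contributes at most 2 whatever its
  starting phase; the incomplete block has fewer than \<open>e\<close> terms of size at most
  1/2.\<close>

lemma abs_sum_frac_le:
  fixes x \<theta> :: real
  assumes e: "e > 0" and cop: "coprime j e" and th: "\<bar>\<theta> - of_int j / of_int e\<bar> \<le> 1 / of_int e ^ 2"
    and "n \<ge> 0"
  shows "\<bar>\<Sum>i\<in>{0..<n}. frac (x + of_int i * \<theta>) - 1 / 2\<bar> \<le> 2 * of_int n / of_int e + of_int e"
proof -
  let ?g = "\<lambda>i. frac (x + of_int i * \<theta>) - 1 / 2"
  define M where "M = n div e"
  have M: "M \<ge> 0" "e * M \<le> n" "n - e * M \<le> e" "e * M \<ge> 0"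
  proof -
    have "e * M + n mod e = n" by (simp add: M_def)
    moreover have "0 \<le> n mod e" "n mod e < e" using e by simp_all
    ultimately show "e * M \<le> n" "n - e * M \<le> e" by linarith+
    show "M \<ge> 0" using assms by (simp add: M_def pos_imp_zdiv_nonneg_iff)
    then show "e * M \<ge> 0" using e by simp
  qed
  have "{0..<n} = {0..<e * M} \<union> {e * M..<n}"
    using M(2,4) by (intro set_eqI) (simp, linarith)
  then have "sum ?g {0..<n} = sum ?g {0..<e * M} + sum ?g {e * M..<n}"
    by (simp add: sum.union_disjoint)
  moreover have "\<bar>sum ?g {0..<e * M}\<bar> \<le> 2 * of_int M"
  proof -
    have "sum ?g {0..<e * M} = (\<Sum>k\<in>{0..<M}. \<Sum>i\<in>{0..<e}. frac ((x + of_int (e * k) * \<theta>) + of_int i * \<theta>) - 1 / 2)"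
      using e M by (subst sum_int_blocks) (simp_all add: algebra_simps)
    also have "\<bar>\<dots>\<bar> \<le> (\<Sum>k\<in>{0..<M}. 2)"
      by (intro order_trans[OF sum_abs] sum_mono abs_sum_frac_block_le[OF e cop th])
    finally show ?thesis using M by simp
  qed
  moreover have "\<bar>sum ?g {e * M..<n}\<bar> \<le> of_int e"
  proof -
    have "\<bar>?g i\<bar> \<le> 1 / 2" for i
      using frac_ge_0[of "x + of_int i * \<theta>"] frac_lt_1[of "x + of_int i * \<theta>"] by linarith
    then have "\<bar>sum ?g {e * M..<n}\<bar> \<le> (\<Sum>i\<in>{e * M..<n}. 1 / 2)"
      by (intro order_trans[OF sum_abs] sum_mono)
    also have "\<dots> = of_int (n - e * M) / 2" using M by simp
    also have "\<dots> \<le> of_int e"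
    proof -
      have *: "x \<le> y \<Longrightarrow> y > 0 \<Longrightarrow> x / 2 \<le> y" for x y :: real by linarith
      show ?thesis
        by (rule *) (use M(3) e in \<open>simp_all only: of_int_le_iff of_int_0_less_iff\<close>)
    qed
    finally show ?thesis .
  qed
  moreover have "of_int M \<le> of_int n / real_of_int e"
    using M e by (simp add: field_simps flip: of_int_mult)
  ultimately show ?thesis by linarith
qed

section \<open>Partial summation and the bound for a single Dedekind sum\<close>

lemma abel_summation_linear:
  fixes x :: "nat \<Rightarrow> real"
  shows "(\<Sum>i<n. (w + real i * v) * x i) = (w + real n * v) * (\<Sum>i<n. x i) - v * (\<Sum>k<n. \<Sum>i<Suc k. x i)"
  by (induction n) (simp_all add: algebra_simps)

lemma saw_eq_frac:
  assumes "q > 0" "\<not> q dvd n"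
  shows "saw n q = frac (of_int n / of_int q) - 1 / 2"
proof -
  have "of_int n / real_of_int q \<notin> \<int>"
  proof
    assume "of_int n / real_of_int q \<in> \<int>"
    then obtain z where "of_int n / real_of_int q = of_int z" by (elim Ints_cases)
    then have "real_of_int n = of_int (q * z)" using assms by (simp add: field_simps)
    then have "n = q * z" by linarith
    with assms show False by simp
  qed
  then show ?thesis by (simp add: saw_def sawtooth_def frac_def)
qed

text \<open>The factor \<open>saw r d\<close> is linear in \<open>r\<close>, so partial summation
  leaves only partial sums of centred fractional parts, each at most \<open>B\<close>. The end
  weight 1/2 costs \<open>B / 2\<close>, and the variation of the weights at most another
  \<open>B\<close>.\<close>

lemma abs_gen_dedekind_le_approx:
  assumes d: "d > 0" and "coprime h d" and e: "e > 0" and cop: "coprime j e"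
    and th: "\<bar>of_int h / of_int d - of_int j / of_int e\<bar> \<le> (1 :: real) / of_int e ^ 2"
  shows "\<bar>gen_dedekind 1 h d\<bar> \<le> 3 / 2 * (2 * of_int d / of_int e + of_int e)"
proof -
  define B where "B = 2 * real_of_int d / of_int e + of_int e"
  define \<theta> where "\<theta> = of_int h / real_of_int d"
  \<comment> \<open>\<open>x i\<close> belongs to \<open>r = i + 1\<close>: the term
    \<open>r = 0\<close> vanishes, so the phase starts at \<open>\<theta>\<close>.\<close>
  define x where "x i = frac (\<theta> + real i * \<theta>) - 1 / 2" for i
  define n where "n = nat d - 1"
  have n: "int n = d - 1" using d by (simp add: n_def)
  have B: "B \<ge> 0" using d e by (simp add: B_def)
  have T: "\<bar>\<Sum>i<k. x i\<bar> \<le> B" if "k \<le> n" for k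
  proof -
    have "\<bar>\<Sum>i\<in>{0..<int k}. frac (\<theta> + of_int i * \<theta>) - 1 / 2\<bar> \<le> 2 * of_int (int k) / of_int e + of_int e"
      using e cop th by (intro abs_sum_frac_le) (auto simp: \<theta>_def)
    also have "\<dots> \<le> B"
    proof -
      have "real k \<le> of_int d" using that n by linarith
      then show ?thesis using e by (simp add: B_def divide_right_mono)
    qed
    finally show ?thesis unfolding sum_int_eq_sum_nat x_def by simp
  qed
  have "nat d = Suc n" using d by (simp add: n_def)
  have "gen_dedekind 1 h d = (\<Sum>r<nat d. saw (int r) d * saw (h * int r) d)"
    using sum_int_eq_sum_nat[of "\<lambda>r. saw r d * saw (h * r) d" "nat d"] d by (simp add: gen_dedekind_def)
  also have "\<dots> = (\<Sum>i<n. saw (int (Suc i)) d * saw (h * int (Suc i)) d)"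
    unfolding \<open>nat d = Suc n\<close> by (subst sum.lessThan_Suc_shift) simp
  also have "\<dots> = (\<Sum>i<n. ((1 / of_int d - 1 / 2) + real i * (1 / of_int d)) * x i)"
  proof (rule sum.cong)
    fix i assume "i \<in> {..<n}"
    then have i: "0 < int (Suc i)" "int (Suc i) < d" using n by auto
    have "\<not> d dvd int (Suc i)" using i zdvd_not_zless by blast
    \<comment> \<open>Coprimality keeps \<open>h * r\<close> off the multiples of \<open>d\<close>,
      the only places where the sawtooth differs from the centred fractional part.\<close>
    then have "\<not> d dvd h * int (Suc i)"
      using assms(2) coprime_commute coprime_dvd_mult_right_iff by blast
    then have "saw (h * int (Suc i)) d = x i"
      using d by (simp add: saw_eq_frac x_def \<theta>_def field_simps)
    moreover have "saw (int (Suc i)) d = (1 / of_int d - 1 / 2) + real i * (1 / of_int d)"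
      unfolding saw_small[OF i] using d by (simp add: field_simps)
    ultimately show "saw (int (Suc i)) d * saw (h * int (Suc i)) d =
        ((1 / of_int d - 1 / 2) + real i * (1 / of_int d)) * x i" by simp
  qed simp
  also have "\<dots> = 1 / 2 * (\<Sum>i<n. x i) - 1 / of_int d * (\<Sum>k<n. \<Sum>i<Suc k. x i)"
  proof -
    \<comment> \<open>The end weight is that of \<open>r = n + 1 = d\<close>.\<close>
    have "1 / of_int d - 1 / 2 + real n * (1 / real_of_int d) = (1 / 2 :: real)"
    proof -
      have "real n = of_int d - 1" using n by linarith
      then show ?thesis using d by (simp add: field_simps)
    qed
    then show ?thesis unfolding abel_summation_linear by simp
  qed
  finally have s: "gen_dedekind 1 h d = \<dots>" .
  have "\<bar>1 / real_of_int d * (\<Sum>k<n. \<Sum>i<Suc k. x i)\<bar> \<le> 1 / of_int d * (\<Sum>k<n. B)"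
  proof -
    have "\<bar>\<Sum>k<n. \<Sum>i<Suc k. x i\<bar> \<le> (\<Sum>k<n. B)"
      by (rule order_trans[OF sum_abs], rule sum_mono, rule T) simp
    then show ?thesis
      unfolding abs_mult using d by (intro mult_mono) auto
  qed
  also have "\<dots> = (real n / of_int d) * B" by simp
  also have "\<dots> \<le> 1 * B"
  proof (intro mult_right_mono B)
    have "real n \<le> of_int d" using n by linarith
    then show "real n / of_int d \<le> 1" using d by simp
  qed
  finally show ?thesis using T[of n] s unfolding B_def[symmetric] by linarith
qed

section \<open>Mean square by covering the residues with arcs around fractions\<close>

lemma sum_le_sum_cover:
  fixes f :: "'a \<Rightarrow> real"
  assumes "finite I" "\<And>i. i \<in> I \<Longrightarrow> finite (B i)" "A \<subseteq> (\<Union>i\<in>I. B i)" "\<And>x. f x \<ge> 0"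
  shows "sum f A \<le> (\<Sum>i\<in>I. sum f (B i))"
proof -
  have "sum f A \<le> sum f (\<Union>i\<in>I. B i)"
    using assms by (intro sum_mono2) auto
  also have "\<dots> \<le> (\<Sum>i\<in>I. sum f (B i))"
    using assms(1,2)
  proof (induction I rule: finite_induct)
    case (insert i I)
    have "sum f (\<Union>i\<in>insert i I. B i) = sum f (B i \<union> (\<Union>i\<in>I. B i))" by simp
    also have "\<dots> \<le> sum f (B i) + sum f (\<Union>i\<in>I. B i)"
      using sum.union_inter[of "B i" "\<Union>i\<in>I. B i" f] sum_nonneg[of "B i \<inter> (\<Union>i\<in>I. B i)" f] insert assms(4)
      by simp
    finally show ?case using insert by simp
  qed simp
  finally show ?thesis .
qed

lemma card_int_interval_le:
  assumes "r \<ge> 0"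
  shows "finite {h :: int. \<bar>of_int h - x\<bar> \<le> r}" "real (card {h :: int. \<bar>of_int h - x\<bar> \<le> r}) \<le> 2 * r + 1"
proof -
  have *: "{h :: int. \<bar>of_int h - x\<bar> \<le> r} = {\<lceil>x - r\<rceil>..\<lfloor>x + r\<rfloor>}"
    by (auto simp: abs_le_iff ceiling_le_iff le_floor_iff)
  show "finite {h :: int. \<bar>of_int h - x\<bar> \<le> r}" unfolding * by simp
  show "real (card {h :: int. \<bar>of_int h - x\<bar> \<le> r}) \<le> 2 * r + 1"
    unfolding * using assms of_int_floor_le[of "x + r"] le_of_int_ceiling[of "x - r"]
    by (simp add: of_nat_nat) linarith
qed

lemma sum_inverse_squares_from:
  assumes "n > 0"
  shows "(\<Sum>i=n..N. 1 / real i ^ 2) \<le> 2 / real n"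
proof (cases "n \<le> N")
  case True
  \<comment> \<open>The extra \<open>- 1 / N\<close> carries the induction: the new term
    \<open>1 / (N + 1)^2\<close> is at most the drop from \<open>1 / N\<close> to
    \<open>1 / (N + 1)\<close>.\<close>
  have "(\<Sum>i=n..N. 1 / real i ^ 2) \<le> 2 / real n - 1 / real N"
    using True
  proof (induction N rule: dec_induct)
    case base
    have "1 / real n ^ 2 \<le> 1 / real n" using assms by (simp add: field_simps power2_eq_square)
    then show ?case by simp
  next
    case (step N)
    have "1 / real (Suc N) ^ 2 \<le> 1 / real N - 1 / real (Suc N)"
    proof -
      have "1 / real (Suc N) ^ 2 \<le> 1 / (real N * real (Suc N))"
        using step assms by (intro divide_left_mono) (auto simp: power2_eq_square)
      also have "\<dots> = 1 / real N - 1 / real (Suc N)"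
        using step assms by (simp add: field_simps)
      finally show ?thesis .
    qed
    then show ?case using step by simp
  qed
  then show ?thesis by (smt (verit) of_nat_0_le_iff zero_le_divide_1_iff)
qed simp

text \<open>Every \<open>h / d\<close> lies near some \<open>j / e\<close> with
  \<open>e \<le> sqrt d\<close>, where the Dedekind sum is at most \<open>5 * d / e\<close>. Each
  such fraction attracts at most \<open>5 * sqrt d / e\<close> values of \<open>h\<close>, and there
  are \<open>e + 1\<close> values of \<open>j\<close>, so the denominator \<open>e\<close>
  contributes \<open>O(d^(5/2) / e^2)\<close>, which is summable over \<open>e\<close>.\<close>

lemma sum_gen_dedekind_squares_le:
  assumes d: "d > 0"
  shows "(\<Sum>h\<in>{h\<in>{0..<d}. coprime h d}. gen_dedekind 1 h d ^ 2) \<le> 500 * sqrt (of_int d) ^ 5"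
proof -
  define D where "D = real_of_int d"
  define N where "N = nat \<lfloor>sqrt D\<rfloor>"
  have D: "D \<ge> 1" using d by (simp add: D_def)
  then have "sqrt D \<ge> 1" by simp
  then have "\<lfloor>sqrt D\<rfloor> \<ge> 1" by (simp add: le_floor_iff)
  moreover from this have "real N = of_int \<lfloor>sqrt D\<rfloor>" by (simp add: N_def)
  ultimately have N: "N \<ge> 1" "real N \<le> sqrt D" "sqrt D \<le> 2 * real N"
    using floor_correct[of "sqrt D"] by linarith+
  have sD: "sqrt D * sqrt D = D" using D by simp
  \<comment> \<open>The arc around \<open>j / e\<close>, in the scale of \<open>h\<close>: Dirichlet
    gives the distance \<open>D / (e * N)\<close>, and \<open>D / N \<le> 2 * sqrt D\<close>. Below,
    \<open>H'\<close> builds the size bound into the cover.\<close>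
  define H where "H e j = {h\<in>{0..<d}. coprime h d} \<inter> {h. \<bar>of_int h - of_int j * D / real e\<bar> \<le> 2 * sqrt D / real e}"
    for e :: nat and j :: int
  define H' where "H' e j = {h\<in>H e j. gen_dedekind 1 h d ^ 2 \<le> 25 * D ^ 2 / real e ^ 2}" for e j
  define P where "P = Sigma {1..N} (\<lambda>e. {0..int e})"
  have "{h\<in>{0..<d}. coprime h d} \<subseteq> (\<Union>p\<in>P. H' (fst p) (snd p))"
  proof
    fix h assume h: "h \<in> {h\<in>{0..<d}. coprime h d}"
    obtain j e where je: "coprime j e" "0 < e" "e \<le> int N" "\<bar>of_int e * (of_int h / D) - of_int j\<bar> < 1 / N"
      using Dirichlet_approx_coprime[of N "of_int h / D"] N by auto
    have e: "of_int e \<le> real N" "real_of_int e > 0" using je by linarith+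
    have 1: "\<bar>of_int h / D - of_int j / of_int e\<bar> \<le> 1 / (of_int e * N)"
    proof -
      have "\<bar>of_int h / D - of_int j / of_int e\<bar> = \<bar>of_int e * (of_int h / D) - of_int j\<bar> / of_int e"
      proof -
        have "of_int h / D - of_int j / of_int e = (of_int e * (of_int h / D) - of_int j) / of_int e"
          using e by (simp add: diff_divide_distrib)
        then show ?thesis using e by (simp add: abs_divide)
      qed
      also have "\<dots> \<le> (1 / N) / of_int e"
        using je e by (intro divide_right_mono) auto
      finally show ?thesis by (simp add: mult.commute)
    qed
    also have "\<dots> \<le> 1 / of_int e ^ 2"
      using e by (simp add: power2_eq_square frac_le)
    finally have 2: "\<bar>gen_dedekind 1 h d\<bar> \<le> 3 / 2 * (2 * D / of_int e + of_int e)"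
      unfolding D_def using abs_gen_dedekind_le_approx[of d h e j] h d je by auto
    have "of_int e * of_int e \<le> sqrt D * sqrt D"
      using e N D by (intro mult_mono) auto
    then have "of_int e \<le> D / of_int e" using e sD by (simp add: field_simps)
    \<comment> \<open>Because \<open>e \<le> D / e\<close>, the bound is at most
      \<open>9 / 2 * D / e\<close>.\<close>
    with 2 have "\<bar>gen_dedekind 1 h d\<bar> \<le> 5 * D / of_int e" by (simp add: field_simps)
    then have "\<bar>gen_dedekind 1 h d\<bar> ^ 2 \<le> (5 * D / of_int e) ^ 2"
      by (intro power_mono) auto
    then have 3: "gen_dedekind 1 h d ^ 2 \<le> 25 * D ^ 2 / of_int e ^ 2"
      by (simp add: power_divide power_mult_distrib)
    have 4: "\<bar>of_int h - of_int j * D / of_int e\<bar> \<le> 2 * sqrt D / of_int e"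
    proof -
      have "\<bar>of_int h - of_int j * D / of_int e\<bar> = D * \<bar>of_int h / D - of_int j / of_int e\<bar>"
      proof -
        have "of_int h - of_int j * D / of_int e = D * (of_int h / D - of_int j / of_int e)"
          using D by (simp add: right_diff_distrib)
        then show ?thesis using D by (simp only: abs_mult)
      qed
      also have "\<dots> \<le> D * (1 / (of_int e * N))"
        using 1 D by (intro mult_left_mono) auto
      also have "\<dots> = sqrt D * (sqrt D / N) / of_int e" using sD by simp
      also have "\<dots> \<le> sqrt D * 2 / of_int e"
        using N e D by (intro divide_right_mono mult_left_mono) (auto simp: field_simps)
      finally show ?thesis by (simp add: mult.commute)
    qed
    \<comment> \<open>The approximated number lies in \<open>[0, e]\<close> and the error is below
      1, so the integer \<open>j\<close> cannot leave this range.\<close>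
    have j: "0 \<le> j" "j \<le> e"
    proof -
      have "0 \<le> of_int h / D" "of_int h / D \<le> 1" using h D by (auto simp: D_def)
      then have "0 \<le> of_int e * (of_int h / D)" "of_int e * (of_int h / D) \<le> of_int e"
        using e mult_nonneg_nonneg[of "of_int e" "of_int h / D"] mult_left_mono[of "of_int h / D" 1 "of_int e"]
        by simp_all
      moreover have "1 / real N \<le> 1" using N by simp
      ultimately have "real_of_int j > -1" "real_of_int j < of_int e + 1" using je by linarith+
      then show "0 \<le> j" "j \<le> e" by linarith+
    qed
    have "(nat e, j) \<in> P" using je j by (auto simp: P_def)
    moreover have "h \<in> H' (nat e) j" using h 3 4 je by (auto simp: H'_def H_def)
    ultimately show "h \<in> (\<Union>p\<in>P. H' (fst p) (snd p))" by force
  qed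
  moreover have "finite P" by (simp add: P_def)
  moreover have "finite (H' e j)" for e j
    by (rule finite_subset[of _ "{0..<d}"]) (auto simp: H'_def H_def)
  ultimately have "(\<Sum>h\<in>{h\<in>{0..<d}. coprime h d}. gen_dedekind 1 h d ^ 2)
      \<le> (\<Sum>p\<in>P. \<Sum>h\<in>H' (fst p) (snd p). gen_dedekind 1 h d ^ 2)"
    by (intro sum_le_sum_cover) auto
  also have "\<dots> = (\<Sum>e\<in>{1..N}. \<Sum>j\<in>{0..int e}. \<Sum>h\<in>H' e j. gen_dedekind 1 h d ^ 2)"
    unfolding P_def by (simp add: sum.Sigma split_def)
  also have "\<dots> \<le> (\<Sum>e\<in>{1..N}. \<Sum>j\<in>{0..int e}. (5 * sqrt D / real e) * (25 * D ^ 2 / real e ^ 2))"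
  proof (intro sum_mono)
    fix e j assume e: "e \<in> {1..N}"
    have "(\<Sum>h\<in>H' e j. gen_dedekind 1 h d ^ 2) \<le> (\<Sum>h\<in>H' e j. 25 * D ^ 2 / real e ^ 2)"
      by (intro sum_mono) (auto simp: H'_def)
    also have "\<dots> = real (card (H' e j)) * (25 * D ^ 2 / real e ^ 2)" by simp
    also have "\<dots> \<le> (5 * sqrt D / real e) * (25 * D ^ 2 / real e ^ 2)"
    proof (intro mult_right_mono)
      let ?S = "{h :: int. \<bar>of_int h - of_int j * D / real e\<bar> \<le> 2 * sqrt D / real e}"
      have S: "finite ?S" "real (card ?S) \<le> 2 * (2 * sqrt D / real e) + 1"
        using D by (intro card_int_interval_le; simp)+
      have "card (H' e j) \<le> card ?S"
        using S by (intro card_mono) (auto simp: H'_def H_def)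
      \<comment> \<open>The arc holds at most \<open>4 * sqrt D / e + 1\<close> integers; this
        inequality absorbs the 1.\<close>
      moreover have "1 \<le> sqrt D / real e" using e N by auto
      ultimately show "real (card (H' e j)) \<le> 5 * sqrt D / real e" using S by simp
    qed auto
    finally show "(\<Sum>h\<in>H' e j. gen_dedekind 1 h d ^ 2) \<le> (5 * sqrt D / real e) * (25 * D ^ 2 / real e ^ 2)" .
  qed
  also have "\<dots> \<le> (\<Sum>e\<in>{1..N}. 250 * (sqrt D * D ^ 2) * (1 / real e ^ 2))"
  proof (intro sum_mono)
    fix e assume "e \<in> {1..N}"
    then have e: "real e \<ge> 1" by simp
    have "(\<Sum>j\<in>{0..int e}. (5 * sqrt D / real e) * (25 * D ^ 2 / real e ^ 2))
        = (real e + 1) / real e * (125 * (sqrt D * D ^ 2) * (1 / real e ^ 2))"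
      by (simp add: field_simps)
    also have "\<dots> \<le> 2 * (125 * (sqrt D * D ^ 2) * (1 / real e ^ 2))"
      using e D by (intro mult_right_mono) (auto simp: field_simps)
    finally show "(\<Sum>j\<in>{0..int e}. (5 * sqrt D / real e) * (25 * D ^ 2 / real e ^ 2))
        \<le> 250 * (sqrt D * D ^ 2) * (1 / real e ^ 2)" by simp
  qed
  also have "\<dots> = 250 * (sqrt D * D ^ 2) * (\<Sum>e\<in>{1..N}. 1 / real e ^ 2)"
    by (rule sum_distrib_left[symmetric])
  also have "\<dots> \<le> 250 * (sqrt D * D ^ 2) * 2"
    using sum_inverse_squares_from[of 1 N] D by (intro mult_left_mono) auto
  also have "sqrt D * D ^ 2 = sqrt D ^ 5"
  proof -
    have "sqrt D ^ 5 = sqrt D * (sqrt D ^ 2) ^ 2" by (simp add: power_mult[symmetric] power_Suc[symmetric] del: real_sqrt_pow2)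
    then show ?thesis using D by simp
  qed
  finally show ?thesis by (simp add: D_def)
qed

section \<open>The error of the main term\<close>

text \<open>For \<open>d\<close> prime to \<open>k\<close>, \<open>gen_dedekind c d k\<close> is up
  to sign the Dedekind sum of the \<open>h\<close> with
  \<open>h * d \<equiv> \<plusminus>c (mod k)\<close>; the subtracted term is the dominant one in
  the three-term relation.\<close>

definition ded_error :: "nat \<Rightarrow> nat \<Rightarrow> nat \<Rightarrow> real" where
  "ded_error k c d = gen_dedekind (int c) (int d) (int k) - real k / (12 * real c * real d)"

text \<open>The three-term relation trades the modulus \<open>k\<close> for the small moduli
  \<open>c\<close> and \<open>d\<close>.\<close>

lemma ded_error_eq:
  assumes "k > 0" "c > 0" "d > 0" "coprime k c" "coprime c d" "coprime d k"
  shows "ded_error k c d = (real c / (real d * real k) + real d / (real k * real c)) / 12 - 1 / 4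
    - gen_dedekind (int k) (int d) (int c) - gen_dedekind (int k) (int c) (int d)"
proof -
  have *: "x - p / 12 = (q + r) / 12 - 1 / 4 - y - z" if "x + y + z = (p + q + r) / 12 - 1 / 4" for x y z p q r :: real
    using that by (simp add: field_simps)
  have "gen_dedekind c d k + gen_dedekind k d c + gen_dedekind k c d =
      (real k / (real c * real d) + real c / (real d * real k) + real d / (real k * real c)) / 12 - 1 / 4"
    using gen_dedekind_three_term[of "int k" "int c" "int d"] assms gen_dedekind_commute[of "int d" "int k" "int c"]
    by simp
  from *[OF this] show ?thesis
    by (simp add: ded_error_def mult.assoc)
qed

text \<open>The elementary part is at most 1/4 because \<open>c, d \<le> k\<close>. Trivial bounds
  for the two small sums give the pointwise estimate; the squared form keeps these sums explicit so
  that they can be averaged.\<close>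

lemma
  assumes "c > 0" "d > 0" "c \<le> k" "d \<le> k" "coprime k c" "coprime c d" "coprime d k"
  shows abs_ded_error_le: "\<bar>ded_error k c d\<bar> \<le> real c + real d"
    and ded_error_sq_le: "ded_error k c d ^ 2 \<le>
      3 * (1 + gen_dedekind (int k) (int d) (int c) ^ 2 + gen_dedekind (int k) (int c) (int d) ^ 2)"
proof -
  define x where "x = (real c / (real d * real k) + real d / (real k * real c)) / 12 - 1 / 4"
  define y where "y = gen_dedekind (int k) (int d) (int c)"
  define z where "z = gen_dedekind (int k) (int c) (int d)"
  have E: "ded_error k c d = x - y - z"
    using ded_error_eq[of k c d] assms by (simp add: x_def y_def z_def)
  have 1: "real a / (real b * real k) \<le> 1" if "a \<le> k" "b > 0" for a b
  proof -
    have "real a \<le> real b * real k"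
      using that mult_mono[of 1 "real b" "real a" "real k"] by simp
    then show ?thesis using that by (cases "k = 0") (auto simp: field_simps)
  qed
  have "real c / (real d * real k) \<le> 1" "real d / (real k * real c) \<le> 1"
    using 1[of c d] 1[of d c] assms by (simp_all add: mult.commute)
  moreover have "real c / (real d * real k) \<ge> 0" "real d / (real k * real c) \<ge> 0" by simp_all
  moreover have "\<bar>(p + q) / 12 - 1 / 4\<bar> \<le> 1 / 4" if "p \<le> 1" "q \<le> 1" "p \<ge> 0" "q \<ge> 0" for p q :: real
    using that by (simp add: abs_le_iff)
  ultimately have x: "\<bar>x\<bar> \<le> 1 / 4" unfolding x_def by blast
  have yz: "\<bar>y\<bar> \<le> real c / 4" "\<bar>z\<bar> \<le> real d / 4"
    using abs_gen_dedekind_le[of "int c"] abs_gen_dedekind_le[of "int d"] assms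
    by (simp_all add: y_def z_def)
  show "\<bar>ded_error k c d\<bar> \<le> real c + real d"
    using x yz assms unfolding E by linarith
  have "x ^ 2 \<le> 1" using x by (simp add: abs_square_le_1)
  moreover have "(x - y - z) ^ 2 \<le> 3 * (x ^ 2 + y ^ 2 + z ^ 2)"
  proof -
    have "3 * (x ^ 2 + y ^ 2 + z ^ 2) - (x - y - z) ^ 2 = (x + y) ^ 2 + (x + z) ^ 2 + (y - z) ^ 2"
      by (simp add: power2_eq_square algebra_simps)
    then show ?thesis by (smt (verit) zero_le_power2)
  qed
  moreover from calculation(1) have "3 * (x ^ 2 + y ^ 2 + z ^ 2) \<le> 3 * (1 + y ^ 2 + z ^ 2)"
    by simp
  ultimately show "ded_error k c d ^ 2 \<le>
      3 * (1 + gen_dedekind (int k) (int d) (int c) ^ 2 + gen_dedekind (int k) (int c) (int d) ^ 2)"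
    unfolding E y_def[symmetric] z_def[symmetric] by (meson order_trans)
qed

section \<open>Mean square of the error over coprime pairs\<close>

lemma sum_gen_dedekind_squares_residues_le:
  assumes "d > 0" "coprime k d"
  shows "(\<Sum>c\<in>{0..<d}. of_bool (coprime c d) * gen_dedekind k c d ^ 2) \<le> 500 * sqrt (of_int d) ^ 5"
proof -
  let ?f = "\<lambda>c. of_bool (coprime c d) * gen_dedekind k c d ^ 2"
  \<comment> \<open>Substituting \<open>c = k * x\<close> and cancelling the unit \<open>k\<close>
    gives the classical sums averaged before.\<close>
  have "sum ?f {0..<d} = (\<Sum>x\<in>{0..<d}. ?f (k * x))"
    using sum_periodic_affine[of d k ?f 0] assms
    by (simp add: gen_dedekind_mod coprime_mod_left_iff)
  also have "\<dots> = (\<Sum>x\<in>{0..<d}. of_bool (coprime x d) * gen_dedekind 1 x d ^ 2)"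
    using gen_dedekind_mult[of d k 1] assms by simp
  also have "\<dots> = (\<Sum>h\<in>{h\<in>{0..<d}. coprime h d}. gen_dedekind 1 h d ^ 2)"
    unfolding sum.inter_filter[OF finite_atLeastLessThan_int] by (intro sum.cong) auto
  also have "\<dots> \<le> 500 * sqrt (of_int d) ^ 5"
    by (rule sum_gen_dedekind_squares_le) fact
  finally show ?thesis .
qed

lemma sum_gen_dedekind_squares_upto_le:
  fixes k d X :: nat
  assumes "d > 0" "d \<le> X" "coprime k d"
  shows "(\<Sum>c\<in>{c\<in>{1..X}. coprime c d}. gen_dedekind (int k) (int c) (int d) ^ 2) \<le> 1000 * real X * sqrt (real d) ^ 3"
proof -
  let ?f = "\<lambda>c. of_bool (coprime c (int d)) * gen_dedekind (int k) c (int d) ^ 2"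
  \<comment> \<open>\<open>M\<close> periods of length \<open>d\<close> cover \<open>{1..X}\<close>,
    and \<open>M \<le> 2 * X / d\<close> since \<open>d \<le> X\<close>; this division lowers
    \<open>d^(5/2)\<close> to \<open>d^(3/2)\<close>.\<close>
  define M where "M = X div d + 1"
  have XM: "X < d * M" unfolding M_def using assms
    by (metis Suc_eq_plus1 dividend_less_times_div mult_Suc_right add.commute)
  have "(\<Sum>c\<in>{c\<in>{1..X}. coprime c d}. gen_dedekind (int k) (int c) (int d) ^ 2) = (\<Sum>c\<in>{c\<in>{1..X}. coprime c d}. ?f (int c))"
    by (intro sum.cong) auto
  also have "\<dots> \<le> (\<Sum>c<d * M. ?f (int c))"
    using XM by (intro sum_mono2) auto
  also have "\<dots> = sum ?f {0..<int d * int M}"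
    using sum_int_eq_sum_nat[of ?f "d * M"] by simp
  also have "\<dots> = of_int (int M) * sum ?f {0..<int d}"
    by (rule sum_periodic_blocks) (use assms in \<open>auto simp: gen_dedekind_mod coprime_mod_left_iff\<close>)
  also have "\<dots> \<le> (2 * real X / real d) * (500 * sqrt (real d) ^ 5)"
  proof (intro mult_mono)
    have "real (X div d) \<le> real X / real d" using assms by (simp add: of_nat_div_le_of_nat)
    moreover have "1 \<le> real X / real d" using assms by simp
    ultimately show "of_int (int M) \<le> 2 * real X / real d" by (simp add: M_def)
    show "sum ?f {0..<int d} \<le> 500 * sqrt (real d) ^ 5"
      using sum_gen_dedekind_squares_residues_le[of "int d" "int k"] assms by simp
  qed (auto intro!: sum_nonneg)
  also have "\<dots> = 1000 * real X * sqrt (real d) ^ 3"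
  proof -
    have "sqrt (real d) ^ 5 = sqrt (real d) ^ 3 * (sqrt (real d)) ^ 2"
      by (simp only: power_add[symmetric]) simp
    then show ?thesis using assms by simp
  qed
  finally show ?thesis .
qed

text \<open>Candidates for writing a residue mod \<open>k\<close> as
  \<open>\<plusminus>c / d\<close>; with \<open>X\<close> about \<open>2 * sqrt k\<close> they will
  reach every nonzero residue.\<close>

definition cop_pairs :: "nat \<Rightarrow> (nat \<times> nat) set" where
  "cop_pairs X = {(c, d). c \<in> {1..X} \<and> d \<in> {1..X} \<and> coprime c d}"

lemma finite_cop_pairs [simp]: "finite (cop_pairs X)"
  by (rule finite_subset[of _ "{1..X} \<times> {1..X}"]) (auto simp: cop_pairs_def)

text \<open>Summing \<open>X * d^(3/2)\<close> over \<open>d \<le> X\<close> gives order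
  \<open>X^(7/2)\<close>, and the same with \<open>c\<close> and \<open>d\<close> exchanged.
  Together with at most \<open>X^2\<close> constant terms the factor becomes
  \<open>3 * (1 + 1000 + 1000)\<close>.\<close>

lemma sum_ded_error_squares_le:
  assumes X: "X \<ge> 1" "X \<le> k" and cop: "\<And>c. c \<in> {1..X} \<Longrightarrow> coprime k c"
  shows "(\<Sum>(c, d)\<in>cop_pairs X. ded_error k c d ^ 2) \<le> 6003 * sqrt (real X) ^ 7"
proof -
  define g where "g c d = gen_dedekind (int k) (int c) (int d) ^ 2" for c d
  have S: "(\<Sum>(c, d)\<in>cop_pairs X. g c d) \<le> 1000 * sqrt (real X) ^ 7"
  proof -
    have "(\<Sum>(c, d)\<in>cop_pairs X. g c d) = (\<Sum>(d, c)\<in>Sigma {1..X} (\<lambda>d. {c\<in>{1..X}. coprime c d}). g c d)"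
      by (rule sum.reindex_bij_witness[of _ prod.swap prod.swap]) (auto simp: cop_pairs_def)
    also have "\<dots> = (\<Sum>d\<in>{1..X}. \<Sum>c\<in>{c\<in>{1..X}. coprime c d}. g c d)"
      by (rule sum.Sigma[symmetric]) auto
    also have "\<dots> \<le> (\<Sum>d\<in>{1..X}. 1000 * real X * sqrt (real X) ^ 3)"
    proof (rule sum_mono)
      fix d assume d: "d \<in> {1..X}"
      then have "(\<Sum>c\<in>{c\<in>{1..X}. coprime c d}. g c d) \<le> 1000 * real X * sqrt (real d) ^ 3"
        unfolding g_def using cop by (intro sum_gen_dedekind_squares_upto_le) auto
      also have "\<dots> \<le> 1000 * real X * sqrt (real X) ^ 3"
        using d by (intro mult_left_mono power_mono) auto
      finally show "(\<Sum>c\<in>{c\<in>{1..X}. coprime c d}. g c d) \<le> 1000 * real X * sqrt (real X) ^ 3" .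
    qed
    also have "\<dots> = 1000 * ((real X) ^ 2 * sqrt (real X) ^ 3)"
      by (simp add: power2_eq_square)
    also have "(real X) ^ 2 * sqrt (real X) ^ 3 = sqrt (real X) ^ 7"
    proof -
      have "sqrt (real X) ^ 7 = (sqrt (real X) ^ 2) ^ 2 * sqrt (real X) ^ 3"
        by (simp only: power_add[symmetric] power_mult[symmetric]) simp
      then show ?thesis by simp
    qed
    finally show ?thesis .
  qed
  have S': "(\<Sum>(c, d)\<in>cop_pairs X. g d c) = (\<Sum>(c, d)\<in>cop_pairs X. g c d)"
    by (rule sum.reindex_bij_witness[of _ prod.swap prod.swap]) (auto simp: cop_pairs_def coprime_commute)
  have "(\<Sum>(c, d)\<in>cop_pairs X. ded_error k c d ^ 2) \<le> (\<Sum>(c, d)\<in>cop_pairs X. 3 * (1 + g d c + g c d))"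
  proof (intro sum_mono, clarify)
    fix c d assume "(c, d) \<in> cop_pairs X"
    then have "c > 0" "d > 0" "c \<le> k" "d \<le> k" "coprime k c" "coprime c d" "coprime d k"
      using X cop by (auto simp: cop_pairs_def coprime_commute)
    from ded_error_sq_le[OF this] show "ded_error k c d ^ 2 \<le> 3 * (1 + g d c + g c d)"
      by (simp add: g_def)
  qed
  also have "\<dots> = 3 * (real (card (cop_pairs X)) + (\<Sum>(c, d)\<in>cop_pairs X. g d c) + (\<Sum>(c, d)\<in>cop_pairs X. g c d))"
    by (simp add: split_def sum_distrib_left[symmetric] sum.distrib)
  also have "real (card (cop_pairs X)) \<le> sqrt (real X) ^ 7"
  proof -
    have "card (cop_pairs X) \<le> card ({1..X} \<times> {1..X})"
      by (rule card_mono) (auto simp: cop_pairs_def)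
    then have "real (card (cop_pairs X)) \<le> real X ^ 2" 
      by (simp add: power2_eq_square del: of_nat_mult add: of_nat_mult[symmetric])
    also have "\<dots> = sqrt (real X) ^ 4"
    proof -
      have "sqrt (real X) ^ 4 = (sqrt (real X) ^ 2) ^ 2" by (simp only: power_mult[symmetric]) simp
      then show ?thesis by simp
    qed
    also have "\<dots> \<le> sqrt (real X) ^ 7"
      using X by (intro power_increasing) auto
    finally show ?thesis .
  qed
  finally show ?thesis using S S' by simp
qed

section \<open>The cross term and the pure error term\<close>

lemma sum_inverse_le_sqrt: "(\<Sum>i=1..n. 1 / real i) \<le> 2 * sqrt (real n)"
proof -
  \<comment> \<open>Cauchy-Schwarz against the convergent sum of inverse squares; the resulting
    \<open>sqrt n\<close> fits into the \<open>k^(7/4)\<close> allowed when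
    \<open>m = 1\<close>.\<close>
  have "(\<Sum>i=1..n. 1 * (1 / real i)) ^ 2 \<le> (\<Sum>i=1..n. 1 ^ 2) * (\<Sum>i=1..n. (1 / real i) ^ 2)"
    by (rule Cauchy_Schwarz_ineq_sum)
  also have "\<dots> \<le> real n * 2"
    using sum_inverse_squares_from[of 1 n] by (intro mult_mono) (auto simp: power_divide intro!: sum_nonneg)
  also have "\<dots> \<le> (2 * sqrt (real n)) ^ 2"
    by (simp add: power_mult_distrib)
  finally have "(\<Sum>i=1..n. 1 / real i) ^ 2 \<le> (2 * sqrt (real n)) ^ 2" by (simp only: mult_1_left)
  then show ?thesis
    by (rule power2_le_imp_le) simp
qed

text \<open>The pointwise bound \<open>c + d\<close> for the error suffices here: for
  \<open>m = 1\<close> the sum costs \<open>k * X^(3/2)\<close>, and for \<open>m \<ge> 2\<close>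
  the remaining series converges. \<open>K\<close> is the fourth root of \<open>k\<close>, so that
  \<open>k^(m + 3/4)\<close> and \<open>k^(2m - 1)\<close> have integer exponents in
  \<open>K\<close>.\<close>

lemma sum_main_times_error_le:
  fixes K :: real
  assumes m: "m > 0" and X: "X \<ge> 1" "X \<le> k" "real X \<le> 2 * K ^ 2" and cop: "\<And>c. c \<in> {1..X} \<Longrightarrow> coprime k c"
    and K: "K \<ge> 1" "K ^ 4 = real k"
  shows "(\<Sum>(c, d)\<in>cop_pairs X. (real k / (12 * real c * real d)) ^ (2 * m - 1) * \<bar>ded_error k c d\<bar>)
    \<le> 16 * (K ^ (4 * m + 3) + K ^ (8 * m - 4))"
proof -
  have *: "(real k / (12 * real c * real d)) ^ (2 * m - 1) * \<bar>ded_error k c d\<bar>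
      \<le> real k ^ (2 * m - 1) * ((1 / (real c * real d)) ^ (2 * m - 1) * (real c + real d))"
    if "(c, d) \<in> cop_pairs X" for c d
  proof -
    have "c > 0" "d > 0" "c \<le> k" "d \<le> k" "coprime k c" "coprime c d" "coprime d k"
      using X cop that by (auto simp: cop_pairs_def coprime_commute)
    note E = abs_ded_error_le[OF this]
    have "(real k / (12 * real c * real d)) ^ (2 * m - 1) * \<bar>ded_error k c d\<bar>
        \<le> (real k / (real c * real d)) ^ (2 * m - 1) * (real c + real d)"
      using E \<open>c > 0\<close> \<open>d > 0\<close> by (intro mult_mono power_mono divide_left_mono) auto
    also have "\<dots> = real k ^ (2 * m - 1) * ((1 / (real c * real d)) ^ (2 * m - 1) * (real c + real d))"
      by (simp add: power_divide)
    finally show ?thesis .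
  qed
  have sub: "(\<Sum>(c, d)\<in>cop_pairs X. f c d) \<le> (\<Sum>c=1..X. \<Sum>d=1..X. f c d)"
    if "\<And>c d. f c d \<ge> 0" for f :: "nat \<Rightarrow> nat \<Rightarrow> real"
  proof -
    have "(\<Sum>(c, d)\<in>cop_pairs X. f c d) \<le> (\<Sum>(c, d)\<in>{1..X} \<times> {1..X}. f c d)"
      using that by (intro sum_mono2) (auto simp: cop_pairs_def)
    then show ?thesis by (simp add: sum.cartesian_product)
  qed
  show ?thesis
  proof (cases "m = 1")
    case True
    have "(\<Sum>(c, d)\<in>cop_pairs X. (real k / (12 * real c * real d)) ^ (2 * m - 1) * \<bar>ded_error k c d\<bar>)
        \<le> (\<Sum>(c, d)\<in>cop_pairs X. real k * (1 / real c + 1 / real d))"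
    proof (intro sum_mono, clarify)
      fix c d assume cd: "(c, d) \<in> cop_pairs X"
      then have "c > 0" "d > 0" by (auto simp: cop_pairs_def)
      then have "(1 / (real c * real d)) ^ (2 * m - 1) * (real c + real d) = 1 / real c + 1 / real d"
        using True by (simp add: field_simps)
      then show "(real k / (12 * real c * real d)) ^ (2 * m - 1) * \<bar>ded_error k c d\<bar>
        \<le> real k * (1 / real c + 1 / real d)" using *[OF cd] unfolding True by simp
    qed
    also have "\<dots> \<le> (\<Sum>c=1..X. \<Sum>d=1..X. real k * (1 / real c + 1 / real d))"
      by (rule sub) simp
    also have "\<dots> = 2 * real k * real X * (\<Sum>c=1..X. 1 / real c)"
    proof -
      have "(\<Sum>c=1..X. real X / real c) = real X * (\<Sum>c=1..X. 1 / real c)"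
        by (simp add: sum_distrib_left)
      then show ?thesis
        by (simp add: sum_distrib_left[symmetric] sum.distrib)
    qed
    also have "\<dots> \<le> 2 * real k * real X * (2 * sqrt (real X))"
      by (intro mult_left_mono sum_inverse_le_sqrt) auto
    also have "\<dots> \<le> 2 * K ^ 4 * (2 * K ^ 2) * (2 * (2 * K))"
    proof (intro mult_mono)
      show "sqrt (real X) \<le> 2 * K"
      proof (rule real_le_lsqrt)
        show "real X \<le> (2 * K) ^ 2" using X(3) zero_le_power2[of K] by (simp add: power_mult_distrib)
      qed (use K in auto)
    qed (use X K in auto)
    also have "\<dots> = 16 * K ^ (4 * m + 3)"
      using True by (simp add: power_add[symmetric] eval_nat_numeral)
    also have "\<dots> \<le> 16 * (K ^ (4 * m + 3) + K ^ (8 * m - 4))" using K by simp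
    finally show ?thesis .
  next
    case False
    with m have m2: "m \<ge> 2" by simp
    have "(\<Sum>(c, d)\<in>cop_pairs X. (real k / (12 * real c * real d)) ^ (2 * m - 1) * \<bar>ded_error k c d\<bar>)
        \<le> (\<Sum>(c, d)\<in>cop_pairs X. real k ^ (2 * m - 1) * (2 * ((1 / real c ^ 2) * (1 / real d ^ 2))))"
    proof (intro sum_mono, clarify)
      fix c d assume cd: "(c, d) \<in> cop_pairs X"
      then have c: "real c \<ge> 1" "real d \<ge> 1" by (auto simp: cop_pairs_def)
      have cd1: "real c * real d \<ge> 1" using mult_mono[OF c] by simp
      \<comment> \<open>The exponent is at least 3 and \<open>c + d \<le> 2 * c * d\<close>, which
        leaves \<open>2 / (c * d)^2\<close>.\<close>
      have "(1 / (real c * real d)) ^ (2 * m - 1) \<le> (1 / (real c * real d)) ^ 3"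
        using m2 cd1 by (intro power_decreasing) auto
      then have "(1 / (real c * real d)) ^ (2 * m - 1) * (real c + real d) \<le> (1 / (real c * real d)) ^ 3 * (2 * (real c * real d))"
      proof (intro mult_mono)
        have "real c \<le> real c * real d" "real d \<le> real c * real d"
          using c mult_left_mono[of 1 "real d" "real c"] mult_right_mono[of 1 "real c" "real d"] by simp_all
        then show "real c + real d \<le> 2 * (real c * real d)" by linarith
      qed auto
      also have "\<dots> = 2 * ((1 / real c ^ 2) * (1 / real d ^ 2))"
        using c by (simp add: eval_nat_numeral)
      finally have "real k ^ (2 * m - 1) * ((1 / (real c * real d)) ^ (2 * m - 1) * (real c + real d))
        \<le> real k ^ (2 * m - 1) * (2 * ((1 / real c ^ 2) * (1 / real d ^ 2)))"
        by (intro mult_left_mono) auto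
      with *[OF cd] show "(real k / (12 * real c * real d)) ^ (2 * m - 1) * \<bar>ded_error k c d\<bar>
        \<le> real k ^ (2 * m - 1) * (2 * ((1 / real c ^ 2) * (1 / real d ^ 2)))" by linarith
    qed
    also have "\<dots> \<le> (\<Sum>c=1..X. \<Sum>d=1..X. real k ^ (2 * m - 1) * (2 * ((1 / real c ^ 2) * (1 / real d ^ 2))))"
      by (rule sub) simp
    also have "\<dots> = real k ^ (2 * m - 1) * (2 * ((\<Sum>c=1..X. 1 / real c ^ 2) * (\<Sum>d=1..X. 1 / real d ^ 2)))"
      by (subst sum_product) (simp only: sum_distrib_left)
    also have "\<dots> \<le> real k ^ (2 * m - 1) * (2 * (2 * 2))"
      using sum_inverse_squares_from[of 1 X] by (intro mult_left_mono mult_mono) (auto intro!: sum_nonneg)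
    also have "\<dots> = 8 * K ^ (8 * m - 4)"
      unfolding K(2)[symmetric] power_mult[symmetric] by (simp add: diff_mult_distrib2)
    also have "\<dots> \<le> 16 * (K ^ (4 * m + 3) + K ^ (8 * m - 4))" using K by simp
    finally show ?thesis .
  qed
qed

text \<open>Of the \<open>2 * m\<close> factors, \<open>2 * m - 2\<close> are bounded pointwise by
  \<open>c + d \<le> 2 * X \<le> 4 * K^2\<close>; the other two go into the mean square of order
  \<open>X^(7/2)\<close>, that is \<open>K^7\<close>.\<close>

lemma sum_error_power_le:
  fixes K :: real
  assumes m: "m > 0" and X: "X \<ge> 1" "X \<le> k" "real X \<le> 2 * K ^ 2" and cop: "\<And>c. c \<in> {1..X} \<Longrightarrow> coprime k c"
    and K: "K \<ge> 1" "K ^ 4 = real k"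
  shows "(\<Sum>(c, d)\<in>cop_pairs X. ded_error k c d ^ (2 * m)) \<le> 16 ^ m * 50000 * K ^ (4 * m + 3)"
proof -
  have "(\<Sum>(c, d)\<in>cop_pairs X. ded_error k c d ^ (2 * m))
      \<le> (\<Sum>(c, d)\<in>cop_pairs X. (4 * K ^ 2) ^ (2 * (m - 1)) * ded_error k c d ^ 2)"
  proof (intro sum_mono, clarify)
    fix c d assume cd: "(c, d) \<in> cop_pairs X"
    then have "c > 0" "d > 0" "c \<le> k" "d \<le> k" "coprime k c" "coprime c d" "coprime d k"
      using X cop by (auto simp: cop_pairs_def coprime_commute)
    note E = abs_ded_error_le[OF this]
    have "real c \<le> real X" "real d \<le> real X" using cd by (auto simp: cop_pairs_def)
    then have "\<bar>ded_error k c d\<bar> \<le> 4 * K ^ 2" using E X by linarith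
    then have "\<bar>ded_error k c d\<bar> ^ (2 * (m - 1)) \<le> (4 * K ^ 2) ^ (2 * (m - 1))"
      by (intro power_mono) auto
    then have "ded_error k c d ^ (2 * (m - 1)) * ded_error k c d ^ 2 \<le> (4 * K ^ 2) ^ (2 * (m - 1)) * ded_error k c d ^ 2"
      by (intro mult_right_mono) (auto simp: power_even_abs)
    moreover have "2 * (m - 1) + 2 = 2 * m" using m by simp
    ultimately show "ded_error k c d ^ (2 * m) \<le> (4 * K ^ 2) ^ (2 * (m - 1)) * ded_error k c d ^ 2"
      by (simp only: power_add[symmetric])
  qed
  also have "\<dots> = (4 * K ^ 2) ^ (2 * (m - 1)) * (\<Sum>(c, d)\<in>cop_pairs X. ded_error k c d ^ 2)"
    by (simp add: split_def sum_distrib_left)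
  also have "\<dots> \<le> (4 * K ^ 2) ^ (2 * (m - 1)) * (6003 * sqrt (real X) ^ 7)"
    using K by (intro mult_left_mono sum_ded_error_squares_le X cop) auto
  also have "\<dots> \<le> (4 * K ^ 2) ^ (2 * (m - 1)) * (6003 * (2 * K) ^ 7)"
  proof (intro mult_left_mono power_mono)
    show "sqrt (real X) \<le> 2 * K"
    proof (rule real_le_lsqrt)
      show "real X \<le> (2 * K) ^ 2" using X(3) zero_le_power2[of K] by (simp add: power_mult_distrib)
    qed (use K in auto)
  qed (use K in auto)
  \<comment> \<open>\<open>768384 = 6003 * 2^7\<close>; the rounding to 50000 below uses the one
    remaining factor 16.\<close>
  also have "\<dots> = 16 ^ (m - 1) * 768384 * K ^ (4 * m + 3)"
  proof -
    obtain n where n: "m = Suc n" using m by (cases m) auto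
    have "(4 * K ^ 2) ^ (2 * (m - 1)) = 16 ^ n * K ^ (4 * n)"
      by (simp add: n power_mult power_mult_distrib)
    moreover have "K ^ (4 * m + 3) = K ^ (4 * n) * K ^ 7"
      by (simp add: n power_add[symmetric] add.commute)
    ultimately show ?thesis by (simp add: n power_mult_distrib)
  qed
  also have "\<dots> \<le> 16 ^ m * 50000 * K ^ (4 * m + 3)"
  proof (rule mult_right_mono)
    show "16 ^ (m - 1) * 768384 \<le> (16 ^ m * 50000 :: real)" using m by (cases m) auto
  qed (use K in auto)
  finally show ?thesis .
qed

section \<open>The singular series\<close>

text \<open>An unordered sum over the positive integers is the form in which products and
  regroupings of double sums can be handled.\<close>

lemma zeta_nat_has_sum:
  assumes "p \<ge> 2"
  shows "((\<lambda>n. 1 / real n ^ p) has_sum zeta (real p)) {0<..}"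
proof -
  have "summable (\<lambda>n. inverse (real n ^ p))"
    using inverse_power_summable[OF assms, where ?'a = real] by simp
  then have "summable (\<lambda>n. 1 / real (Suc n) ^ p)"
    by (subst (asm) summable_Suc_iff[symmetric]) (simp add: inverse_eq_divide)
  then have "(\<lambda>n. 1 / real (Suc n) ^ p) sums (\<Sum>n. 1 / real (Suc n) ^ p)"
    by (rule summable_sums)
  moreover have "(\<Sum>n. 1 / real (Suc n) ^ p) = zeta (real p)"
    unfolding zeta_def by (simp add: powr_realpow)
  ultimately have "((\<lambda>n. 1 / real (Suc n) ^ p) has_sum zeta (real p)) UNIV"
    by (intro sums_nonneg_imp_has_sum) auto
  moreover have "bij_betw Suc UNIV {0<..}"
    by (rule bij_betwI[where g = "\<lambda>n. n - 1"]) auto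
  ultimately show ?thesis
    using has_sum_reindex_bij_betw[of Suc UNIV "{0<..}" "\<lambda>n. 1 / real n ^ p"] by simp
qed

lemma zeta_nat_pos:
  assumes "p \<ge> 2"
  shows "zeta (real p) > 0"
proof -
  have "(\<Sum>n\<in>{1}. 1 / real n ^ p) \<le> zeta (real p)"
    by (rule finite_sum_le_has_sum[OF zeta_nat_has_sum[OF assms]]) auto
  then show ?thesis by simp
qed

definition all_cop_pairs :: "(nat \<times> nat) set" where
  "all_cop_pairs = {(c, d). 0 < c \<and> 0 < d \<and> coprime c d}"

text \<open>The inverse splits off the gcd, so a sum over all pairs factors into one over the gcd
  and one over coprime pairs.\<close>

lemma bij_betw_scale_cop_pairs:
  "bij_betw (\<lambda>(t, c, d). (t * c, t * d)) ({0<..} \<times> all_cop_pairs) ({0<..} \<times> {0<..})"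
proof (rule bij_betwI[where g = "\<lambda>(a, b). (gcd a b, a div gcd a b, b div gcd a b)"])
  show "(\<lambda>(t, c, d). (t * c, t * d)) \<in> {0<..} \<times> all_cop_pairs \<rightarrow> {0<..} \<times> {0<..}"
    by (auto simp: all_cop_pairs_def)
  show "(\<lambda>(a, b). (gcd a b, a div gcd a b, b div gcd a b)) \<in> {0<..} \<times> {0<..} \<rightarrow> {0<..} \<times> all_cop_pairs"
    by (auto simp: all_cop_pairs_def div_greater_zero_iff gcd_le1_nat gcd_le2_nat intro!: div_gcd_coprime)
  show "(\<lambda>(a, b). (gcd a b, a div gcd a b, b div gcd a b)) ((\<lambda>(t, c, d). (t * c, t * d)) x) = x"
    if "x \<in> {0<..} \<times> all_cop_pairs" for x
    using that by (auto simp: all_cop_pairs_def gcd_mult_distrib_nat[symmetric] coprime_iff_gcd_eq_1)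
  show "(\<lambda>(t, c, d). (t * c, t * d)) ((\<lambda>(a, b). (gcd a b, a div gcd a b, b div gcd a b)) y) = y"
    if "y \<in> {0<..} \<times> {0<..}" for y :: "nat \<times> nat"
    using that by auto
qed

text \<open>Over all positive pairs, \<open>1 / (a * b)^p\<close> sums to
  \<open>\<zeta>(p)^2\<close>. Grouped by gcd the same total is \<open>\<zeta>(2p)\<close> times the
  wanted sum, since scaling a pair by \<open>t\<close> contributes \<open>t^(-2p)\<close>.\<close>

lemma sum_coprime_pairs_zeta:
  assumes p: "p \<ge> 2"
  shows "((\<lambda>(c, d). 1 / (real c * real d) ^ p) has_sum (zeta (real p) ^ 2 / zeta (real (2 * p)))) all_cop_pairs"
proof -
  define f where "f = (\<lambda>(c, d). 1 / (real c * real d) ^ p)"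
  have Z: "((\<lambda>n. 1 / real n ^ p) has_sum zeta (real p)) {0<..}"
    by (rule zeta_nat_has_sum[OF p])
  have Z2: "((\<lambda>n. 1 / real n ^ (2 * p)) has_sum zeta (real (2 * p))) {0<..}"
    by (rule zeta_nat_has_sum) (use p in simp)
  have inner: "((\<lambda>d. f (c, d)) has_sum (1 / real c ^ p * zeta (real p))) {0<..}" for c
    using has_sum_cmult_right[OF Z, of "1 / real c ^ p"] by (simp add: f_def power_mult_distrib)
  have outer: "((\<lambda>c. 1 / real c ^ p * zeta (real p)) has_sum (zeta (real p) * zeta (real p))) {0<..}"
    by (rule has_sum_cmult_left[OF Z])
  have "f summable_on ({0<..} \<times> {0<..})"
    by (rule summable_on_SigmaI[OF inner]) (use outer in \<open>auto simp: f_def summable_on_def\<close>)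
  then have full: "(f has_sum (zeta (real p) ^ 2)) ({0<..} \<times> {0<..})"
    unfolding power2_eq_square by (intro has_sum_SigmaI[OF inner outer])
  \<comment> \<open>Summability is inherited from the full sum, so the value \<open>s\<close> can be
    named before it is known.\<close>
  have "f summable_on all_cop_pairs"
    by (rule summable_on_subset_banach[of _ "{0<..} \<times> {0<..}"])
      (use full in \<open>auto simp: summable_on_def all_cop_pairs_def\<close>)
  then obtain s where s: "(f has_sum s) all_cop_pairs"
    by (auto simp: summable_on_def)
  have "((\<lambda>x. f ((\<lambda>(t, c, d). (t * c, t * d)) x)) has_sum (zeta (real p) ^ 2)) ({0<..} \<times> all_cop_pairs)"
    using full has_sum_reindex_bij_betw[OF bij_betw_scale_cop_pairs] by blast
  moreover have "((\<lambda>x. f ((\<lambda>(t, c, d). (t * c, t * d)) (t, x))) has_sum (1 / real t ^ (2 * p) * s)) all_cop_pairs" for t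
  proof -
    have "f ((\<lambda>(t, c, d). (t * c, t * d)) (t, x)) = 1 / real t ^ (2 * p) * f x" for x
      by (simp add: f_def split_def power_mult_distrib power_mult power2_eq_square)
    then show ?thesis
      using has_sum_cmult_right[OF s, of "1 / real t ^ (2 * p)"] by simp
  qed
  ultimately have "((\<lambda>t. 1 / real t ^ (2 * p) * s) has_sum (zeta (real p) ^ 2)) {0<..}"
    by (rule has_sum_SigmaD)
  then have "zeta (real p) ^ 2 = zeta (real (2 * p)) * s"
    using has_sum_cmult_left[OF Z2, of s] has_sum_unique by blast
  then have "s = zeta (real p) ^ 2 / zeta (real (2 * p))"
    using zeta_nat_pos[of "2 * p"] p by (simp add: field_simps)
  with s show ?thesis by (simp add: f_def)
qed

section \<open>Residues as quotients of small integers\<close>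

text \<open>The bound \<open>sqrt (k / 2)\<close> keeps cross products \<open>c * d'\<close> below
  \<open>k / 2\<close>, which forces distinct signed pairs to represent distinct residues.\<close>

definition small_pairs :: "nat \<Rightarrow> (nat \<times> nat) set" where
  "small_pairs k = {(c, d). 0 < c \<and> 0 < d \<and> coprime c d \<and> 2 * c ^ 2 < k \<and> 2 * d ^ 2 < k}"

text \<open>Multiplying by the unit \<open>d\<close> turns the arguments \<open>1, h\<close> into
  \<open>d, d * h\<close>, and \<open>d * h\<close> reduces to \<open>\<sigma> * c\<close>. The sign
  comes out by oddness and disappears in the even power.\<close>

lemma dedekind_sum_power_eq:
  assumes "k > 0" "coprime d k" "\<sigma> \<in> {1, -1}" "[h * int d = \<sigma> * int c] (mod int k)"
  shows "dedekind_sum h k ^ (2 * m) = gen_dedekind (int c) (int d) (int k) ^ (2 * m)"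
proof -
  have "dedekind_sum h k = gen_dedekind (int d * 1) (int d * h) (int k)"
    using assms by (simp only: dedekind_sum_eq_gen gen_dedekind_mult coprime_int_iff of_nat_0_less_iff)
  also have "\<dots> = gen_dedekind (int d) ((h * int d) mod int k) (int k)"
    using assms by (simp add: gen_dedekind_mod mult.commute)
  also have "\<dots> = gen_dedekind (int d) ((\<sigma> * int c) mod int k) (int k)"
    using assms(4) by (simp add: cong_def)
  also have "\<dots> = gen_dedekind (int d) (\<sigma> * int c) (int k)"
    using assms by (simp add: gen_dedekind_mod)
  also have "\<dots> = of_int \<sigma> * gen_dedekind (int c) (int d) (int k)"
    using assms gen_dedekind_minus[of "int k" "int d" "int c"] gen_dedekind_commute[of "int d" "int c" "int k"] by auto
  finally show ?thesis
    using assms(3) by auto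
qed

text \<open>Dirichlet approximation of \<open>h / k\<close> with denominators up to
  \<open>N = \<lfloor>sqrt k\<rfloor>\<close> yields \<open>d\<close>, and
  \<open>c = h * d - j * k\<close> then has size at most \<open>k / N\<close>. The factor 2 in
  \<open>X\<close> pays for rounding \<open>sqrt k\<close> down.\<close>

lemma exists_small_pair:
  assumes k: "prime k" and h: "h \<in> {1..int k - 1}" and X: "X = nat \<lfloor>2 * sqrt (real k)\<rfloor>" "X < k"
  shows "\<exists>\<sigma> c d. \<sigma> \<in> {1, -1} \<and> (c, d) \<in> cop_pairs X \<and> [h * int d = \<sigma> * int c] (mod int k)"
proof -
  define r where "r = sqrt (real k)"
  define N where "N = nat \<lfloor>r\<rfloor>"
  have k1: "real k > 1" using k prime_gt_1_nat[of k] by simp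
  then have r: "r \<ge> 1" "r * r = real k" by (simp_all add: r_def)
  then have "\<lfloor>r\<rfloor> \<ge> 1" by (simp add: le_floor_iff)
  moreover from this have "real N = of_int \<lfloor>r\<rfloor>" by (simp add: N_def)
  ultimately have N: "N \<ge> 1" "real N \<le> r" "r \<le> 2 * real N"
    using floor_correct[of r] by linarith+
  obtain j d where jd: "coprime j d" "0 < d" "d \<le> int N" "\<bar>of_int d * (of_int h / real k) - of_int j\<bar> < 1 / N"
    using Dirichlet_approx_coprime[of N "of_int h / real k"] N by auto
  define c where "c = h * d - j * int k"
  have "\<bar>real_of_int c\<bar> = real k * \<bar>of_int d * (of_int h / real k) - of_int j\<bar>"
  proof -
    have "real_of_int c = real k * (of_int d * (of_int h / real k) - of_int j)"
      using k1 by (simp add: c_def right_diff_distrib)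
    then show ?thesis by (simp add: abs_mult)
  qed
  also have "\<dots> \<le> real k * (1 / N)"
    using jd by (intro mult_left_mono) auto
  also have "\<dots> = r * (r / N)" using r by simp
  also have "\<dots> \<le> r * 2"
    using N r by (intro mult_left_mono) (auto simp: field_simps)
  finally have c_le: "real (nat \<bar>c\<bar>) \<le> 2 * r" by simp
  have le_X: "a \<le> X" if "real a \<le> 2 * r" for a
    using that unfolding X r_def by (simp add: le_nat_iff le_floor_iff)
  have d_le: "real (nat d) \<le> 2 * r" using jd N r by linarith
  \<comment> \<open>As \<open>k\<close> is prime and divides neither \<open>d\<close> nor
    \<open>h\<close>, it does not divide \<open>h * d\<close>; hence
    \<open>c \<noteq> 0\<close>.\<close>
  then have "nat d < k" using le_X X(2) by fastforce
  then have "\<not> int k dvd d" using jd zdvd_not_zless by auto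
  then have cop_d: "coprime (int k) d" using k prime_imp_coprime by (metis prime_nat_int_transfer)
  have "\<not> int k dvd h" using h zdvd_not_zless by auto
  then have "\<not> int k dvd h * d"
    using cop_d coprime_dvd_mult_left_iff by blast
  then have "c \<noteq> 0" by (auto simp: c_def)
  \<comment> \<open>Modulo \<open>d\<close>, \<open>c\<close> is \<open>- j * k\<close>, and
    \<open>d\<close> is prime to both \<open>j\<close> and \<open>k\<close>.\<close>
  have "coprime (j * int k) d" using jd(1) cop_d by simp
  then have "coprime c d"
  proof -
    have "gcd d (h * d + - (j * int k)) = gcd d (j * int k)"
      by (simp only: gcd_add_mult gcd_neg2)
    then have "gcd c d = gcd (j * int k) d"
      by (simp add: c_def gcd.commute)
    then show ?thesis using \<open>coprime (j * int k) d\<close> by (simp add: coprime_iff_gcd_eq_1)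
  qed
  then have "coprime (nat \<bar>c\<bar>) (nat d)"
    using jd by (metis coprime_abs_left_iff coprime_int_iff abs_ge_zero int_nat_eq less_imp_le)
  then have "(nat \<bar>c\<bar>, nat d) \<in> cop_pairs X"
    using le_X[OF c_le] le_X[OF d_le] jd \<open>c \<noteq> 0\<close> by (auto simp: cop_pairs_def)
  moreover have "[h * int (nat d) = sgn c * int (nat \<bar>c\<bar>)] (mod int k)"
    using jd by (simp add: sgn_mult_abs c_def cong_iff_dvd_diff)
  moreover have "sgn c \<in> {1, -1}" using \<open>c \<noteq> 0\<close> by (auto simp: sgn_if)
  ultimately show ?thesis by blast
qed

text \<open>The map \<open>\<phi>\<close> sends a signed pair to the residue
  \<open>\<sigma> * c / d\<close>. It reaches every nonzero residue from \<open>cop_pairs X\<close>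
  and is injective on signed small pairs. So small pairs account exactly for the residues in
  \<open>H\<close>, while the other residues are at worst overcounted by the remaining pairs. The
  factor 2 counts the signs.\<close>

lemma sum_dedekind_powers_small_pairs:
  fixes m :: nat
  assumes k: "prime k" and X: "X = nat \<lfloor>2 * sqrt (real k)\<rfloor>" "X < k"
  defines "G \<equiv> \<lambda>(c, d). gen_dedekind (int c) (int d) (int k) ^ (2 * m)"
  shows "small_pairs k \<subseteq> cop_pairs X"
    and "\<bar>(\<Sum>h=1..int k - 1. dedekind_sum h k ^ (2 * m)) - 2 * sum G (small_pairs k)\<bar>
      \<le> 2 * sum G (cop_pairs X - small_pairs k)"
proof -
  show sub: "small_pairs k \<subseteq> cop_pairs X"
  proof -
    have "c \<le> X" if "2 * c ^ 2 < k" for c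
    proof -
      have "real (c ^ 2) \<le> real k" using that by (intro of_nat_mono) auto
      then have "real c \<le> sqrt (real k)" by (simp add: real_le_rsqrt)
      then have "real c \<le> 2 * sqrt (real k)" using real_sqrt_ge_zero[of "real k"] by linarith
      then show ?thesis unfolding X by (simp add: le_nat_iff le_floor_iff)
    qed
    then show ?thesis by (auto simp: small_pairs_def cop_pairs_def)
  qed
  have k0: "k > 0" using k prime_gt_0_nat by blast
  have cop: "coprime d k" if "0 < d" "d \<le> X" for d
    using that X k by (metis coprime_commute dvd_imp_le le_less_trans not_le prime_imp_coprime)
  have "\<exists>v. [int d * v = 1] (mod int k)" if "0 < d" "d \<le> X" for d
    using cong_solve_coprime_int cop[OF that] by simp
  \<comment> \<open>\<open>v d\<close> is an inverse of \<open>d\<close> mod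
    \<open>k\<close>.\<close>
  then obtain v where v: "\<And>d. 0 < d \<Longrightarrow> d \<le> X \<Longrightarrow> [int d * v d = 1] (mod int k)"
    by metis
  define \<phi> where "\<phi> = (\<lambda>(\<sigma>, c, d). (\<sigma> * int c * v d) mod int k)"
  define T where "T = {1, -1 :: int}"
  have \<phi>_cong: "[\<phi> (\<sigma>, c, d) * int d = \<sigma> * int c] (mod int k)" if "(c, d) \<in> cop_pairs X" for \<sigma> c d
  proof -
    have "[(\<sigma> * int c * v d) * int d = \<sigma> * int c * (int d * v d)] (mod int k)"
      by (simp add: mult_ac)
    also have "[\<sigma> * int c * (int d * v d) = \<sigma> * int c * 1] (mod int k)"
      using v[of d] that by (intro cong_mult) (auto simp: cop_pairs_def)
    finally show ?thesis
      unfolding \<phi>_def by (simp add: cong_def mod_mult_left_eq)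
  qed
  have \<phi>_range: "\<phi> (\<sigma>, c, d) \<in> {1..int k - 1}" if "(c, d) \<in> cop_pairs X" "\<sigma> \<in> T" for \<sigma> c d
  proof -
    have "\<phi> (\<sigma>, c, d) \<noteq> 0"
    proof
      assume "\<phi> (\<sigma>, c, d) = 0"
      then have "int k dvd \<sigma> * int c" using \<phi>_cong[OF that(1), of \<sigma>] by (metis cong_0_iff cong_sym_eq mult_zero_left)
      then have "int k dvd int c" using that by (auto simp: T_def)
      then have "k \<le> c" using that by (auto simp: cop_pairs_def dest!: dvd_imp_le)
      then show False using that X by (auto simp: cop_pairs_def)
    qed
    moreover have "0 \<le> \<phi> (\<sigma>, c, d)" "\<phi> (\<sigma>, c, d) < int k"
      using k0 by (simp_all add: \<phi>_def)
    ultimately show ?thesis by auto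
  qed
  define F where "F h = dedekind_sum h k ^ (2 * m)" for h
  have F_nonneg: "F h \<ge> 0" for h by (simp add: F_def)
  have F_\<phi>: "F (\<phi> (\<sigma>, x)) = G x" if "x \<in> cop_pairs X" "\<sigma> \<in> T" for \<sigma> x
  proof -
    obtain c d where x: "x = (c, d)" by (cases x)
    show ?thesis
      using dedekind_sum_power_eq[of k d \<sigma> "\<phi> (\<sigma>, c, d)" c m] that k0 cop[of d] \<phi>_cong[of c d \<sigma>]
      by (auto simp: F_def G_def x T_def cop_pairs_def)
  qed
  have surj: "h \<in> \<phi> ` (T \<times> cop_pairs X)" if h: "h \<in> {1..int k - 1}" for h
  proof -
    obtain \<sigma> c d where cd: "\<sigma> \<in> T" "(c, d) \<in> cop_pairs X" "[h * int d = \<sigma> * int c] (mod int k)"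
      using exists_small_pair[OF k h X] by (auto simp: T_def)
    have "coprime (int d) (int k)" using cop[of d] cd by (simp add: cop_pairs_def)
    moreover have "[h * int d = \<phi> (\<sigma>, c, d) * int d] (mod int k)"
      using cd \<phi>_cong cong_trans cong_sym by blast
    ultimately have "[h = \<phi> (\<sigma>, c, d)] (mod int k)"
      using cong_mult_rcancel by blast
    then have "h = \<phi> (\<sigma>, c, d)"
      using h \<phi>_range[OF cd(2,1)] by (simp add: cong_def)
    then show ?thesis using cd by blast
  qed
  have inj: "inj_on \<phi> (T \<times> small_pairs k)"
  proof (rule inj_onI, clarify)
    fix \<sigma> c d \<sigma>' c' d'
    assume A: "\<sigma> \<in> T" "(c, d) \<in> small_pairs k" "\<sigma>' \<in> T" "(c', d') \<in> small_pairs k"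
      and eq: "\<phi> (\<sigma>, c, d) = \<phi> (\<sigma>', c', d')"
    have "[\<sigma> * int c * int d' = \<phi> (\<sigma>, c, d) * int d * int d'] (mod int k)"
      using \<phi>_cong[of c d \<sigma>] A sub by (intro cong_scalar_right) (auto simp: cong_sym_eq)
    also have "\<phi> (\<sigma>, c, d) * int d * int d' = \<phi> (\<sigma>', c', d') * int d' * int d"
      by (simp add: eq)
    also have "[\<phi> (\<sigma>', c', d') * int d' * int d = \<sigma>' * int c' * int d] (mod int k)"
      using \<phi>_cong[of c' d' \<sigma>'] A sub by (intro cong_scalar_right) auto
    finally have dvd: "int k dvd \<sigma> * int c * int d' - \<sigma>' * int c' * int d"
      by (simp add: cong_iff_dvd_diff)
    \<comment> \<open>The inequality of arithmetic and geometric means applied to \<open>a^2\<close>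
      and \<open>b^2\<close>.\<close>
    have half: "2 * (int a * int b) < int k" if "2 * a ^ 2 < k" "2 * b ^ 2 < k" for a b :: nat
    proof -
      have "2 * (int a * int b) \<le> int a ^ 2 + int b ^ 2"
        using zero_le_power2[of "int a - int b"] by (simp add: power2_diff)
      moreover have "2 * int a ^ 2 < int k" "2 * int b ^ 2 < int k"
        using that by (simp_all flip: of_nat_power of_nat_mult)
      ultimately show ?thesis by linarith
    qed
    have lt: "2 * (int c * int d') < int k" "2 * (int c' * int d) < int k"
      and pos: "int c * int d' > 0" "int c' * int d > 0"
      using A half by (auto simp: small_pairs_def)
    have sg: "\<sigma> = 1 \<or> \<sigma> = -1" "\<sigma>' = 1 \<or> \<sigma>' = -1" using A by (auto simp: T_def)
    \<comment> \<open>Both products are below \<open>k / 2\<close> in size, so being congruent mod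
      \<open>k\<close> they must be equal.\<close>
    have "\<bar>\<sigma> * int c * int d' - \<sigma>' * int c' * int d\<bar> < int k"
      using lt pos sg by auto
    then have z: "\<sigma> * int c * int d' = \<sigma>' * int c' * int d"
      using dvd by (metis dvd_imp_le_int linorder_not_less eq_iff_diff_eq_0 abs_of_nat)
    with sg pos have "\<sigma> = \<sigma>'" and "int c * int d' = int c' * int d" by auto
    then have "c * d' = c' * d" by (metis of_nat_eq_iff of_nat_mult)
    \<comment> \<open>Equal fractions in lowest terms.\<close>
    then have "c = c' \<and> d' = d"
      using A coprime_crossproduct_nat[of c d c' d'] by (auto simp: small_pairs_def)
    then show "\<sigma> = \<sigma>' \<and> (c, d) = (c', d')" using \<open>\<sigma> = \<sigma>'\<close> by simp
  qed
  define H where "H = \<phi> ` (T \<times> small_pairs k)"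
  have sumT: "(\<Sum>(\<sigma>, x)\<in>T \<times> A. G x) = 2 * sum G A" for A
    by (simp add: sum.cartesian_product[symmetric] T_def)
  have "sum F H = (\<Sum>y\<in>T \<times> small_pairs k. F (\<phi> y))"
    unfolding H_def using inj by (simp add: sum.reindex)
  also have "\<dots> = (\<Sum>(\<sigma>, x)\<in>T \<times> small_pairs k. G x)"
    using F_\<phi> sub by (intro sum.cong) (auto simp del: split_paired_All)
  finally have 1: "sum F H = 2 * sum G (small_pairs k)" by (simp add: sumT)
  have Hsub: "H \<subseteq> {1..int k - 1}" unfolding H_def using \<phi>_range sub by fastforce
  then have 2: "sum F {1..int k - 1} = sum F H + sum F ({1..int k - 1} - H)"
    by (metis finite_atLeastAtMost_int sum.subset_diff add.commute)
  have "{1..int k - 1} - H \<subseteq> \<phi> ` (T \<times> (cop_pairs X - small_pairs k))"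
    using surj unfolding H_def by blast
  then have "sum F ({1..int k - 1} - H) \<le> sum F (\<phi> ` (T \<times> (cop_pairs X - small_pairs k)))"
    using F_nonneg by (intro sum_mono2) (auto simp: T_def)
  \<comment> \<open>Here \<open>\<phi>\<close> may take a value repeatedly; as \<open>F\<close> is
    nonnegative, this only enlarges the right side.\<close>
  also have "\<dots> \<le> (\<Sum>y\<in>T \<times> (cop_pairs X - small_pairs k). F (\<phi> y))"
    using F_nonneg sum_image_le[of "T \<times> (cop_pairs X - small_pairs k)" F \<phi>] by (simp add: T_def o_def)
  also have "\<dots> = (\<Sum>(\<sigma>, x)\<in>T \<times> (cop_pairs X - small_pairs k). G x)"
    using F_\<phi> by (intro sum.cong) (auto simp del: split_paired_All)
  finally have 3: "sum F ({1..int k - 1} - H) \<le> 2 * sum G (cop_pairs X - small_pairs k)"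
    by (simp add: sumT)
  have "sum F ({1..int k - 1} - H) \<ge> 0" using F_nonneg by (simp add: sum_nonneg)
  with 1 2 3 show "\<bar>(\<Sum>h=1..int k - 1. dedekind_sum h k ^ (2 * m)) - 2 * sum G (small_pairs k)\<bar>
      \<le> 2 * sum G (cop_pairs X - small_pairs k)"
    unfolding F_def[symmetric] by linarith
qed

section \<open>The moments\<close>

lemma power_diff_abs_le:
  fixes x y B :: real
  assumes "\<bar>x\<bar> \<le> B" "\<bar>y\<bar> \<le> B"
  shows "\<bar>x ^ n - y ^ n\<bar> \<le> real n * B ^ (n - 1) * \<bar>x - y\<bar>"
proof -
  have "\<bar>\<Sum>i<n. y ^ (n - Suc i) * x ^ i\<bar> \<le> (\<Sum>i<n. B ^ (n - 1))"
  proof (rule order_trans[OF sum_abs], rule sum_mono)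
    fix i assume i: "i \<in> {..<n}"
    have "\<bar>y ^ (n - Suc i) * x ^ i\<bar> = \<bar>y\<bar> ^ (n - Suc i) * \<bar>x\<bar> ^ i"
      by (simp add: abs_mult power_abs)
    also have "\<dots> \<le> B ^ (n - Suc i) * B ^ i"
      using assms by (intro mult_mono power_mono) auto
    also have "\<dots> = B ^ (n - 1)"
      using i by (simp add: power_add[symmetric])
    finally show "\<bar>y ^ (n - Suc i) * x ^ i\<bar> \<le> B ^ (n - 1)" .
  qed
  then have "\<bar>\<Sum>i<n. y ^ (n - Suc i) * x ^ i\<bar> * \<bar>x - y\<bar> \<le> (real n * B ^ (n - 1)) * \<bar>x - y\<bar>"
    by (intro mult_right_mono) auto
  then show ?thesis
    by (simp add: power_diff_sumr2 abs_mult mult.commute)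
qed

lemma power_add_le_sum:
  fixes a b :: real
  assumes "a \<ge> 0" "b \<ge> 0"
  shows "(a + b) ^ n \<le> 2 ^ n * (a ^ n + b ^ n)"
proof -
  have "(a + b) ^ n \<le> (2 * max a b) ^ n"
    using assms by (intro power_mono) auto
  also have "\<dots> = 2 ^ n * max a b ^ n" by (rule power_mult_distrib)
  also have "\<dots> \<le> 2 ^ n * (a ^ n + b ^ n)"
    using assms by (intro mult_left_mono) (auto simp: max_def)
  finally show ?thesis .
qed

text \<open>A coprime pair that is not small has a coordinate at least \<open>n\<close>. Then
  \<open>(c * d)^(p - 2) \<ge> n^(p - 2)\<close>, and the remaining \<open>1 / (c * d)^2\<close>
  sums to at most \<open>(2 / n) * 2\<close>. The choice of the large coordinate doubles
  this.\<close>

lemma sum_not_small_pairs_le: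
  assumes p: "p \<ge> 2" and n: "n > 0" "\<And>c. k \<le> 2 * c ^ 2 \<Longrightarrow> n \<le> c"
    and A: "finite A" "A \<subseteq> all_cop_pairs - small_pairs k"
  shows "(\<Sum>(c, d)\<in>A. 1 / (real c * real d) ^ p) \<le> 8 / real n ^ (p - 1)"
proof -
  define f where "f = (\<lambda>(c, d). 1 / (real c * real d) ^ p)"
  obtain N where N: "fst ` A \<union> snd ` A \<subseteq> {..N}"
    using A(1) finite_nat_iff_bounded_le[of "fst ` A \<union> snd ` A"] by auto
  \<comment> \<open>\<open>B\<close> holds the pairs with large first coordinate, its mirror image
    those with large second coordinate.\<close>
  define B where "B = {n..N} \<times> {1..N}"
  have "A \<subseteq> B \<union> prod.swap ` B"
  proof
    fix x assume x: "x \<in> A"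
    obtain c d where cd: "x = (c, d)" by (cases x)
    have "c \<le> N" "d \<le> N" using N x cd by force+
    moreover have "c > 0" "d > 0" "k \<le> 2 * c ^ 2 \<or> k \<le> 2 * d ^ 2"
      using A(2) x cd by (auto simp: all_cop_pairs_def small_pairs_def)
    ultimately have "(c, d) \<in> B \<or> (d, c) \<in> B" using n(2) by (auto simp: B_def)
    then show "x \<in> B \<union> prod.swap ` B" using cd by force
  qed
  then have "sum f A \<le> sum f (B \<union> prod.swap ` B)"
    by (intro sum_mono2) (auto simp: B_def f_def)
  also have "\<dots> \<le> sum f B + sum f (prod.swap ` B)"
    using sum.union_inter[of B "prod.swap ` B" f] sum_nonneg[of "B \<inter> prod.swap ` B" f]
    by (simp add: B_def f_def split_def)
  also have "sum f (prod.swap ` B) = sum f B"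
    by (subst sum.reindex) (auto simp: f_def split_def mult.commute)
  also have "sum f B \<le> (\<Sum>(c, d)\<in>B. 1 / real n ^ (p - 2) * ((1 / real c ^ 2) * (1 / real d ^ 2)))"
  proof (intro sum_mono, clarify)
    fix c d assume "(c, d) \<in> B"
    then have cd: "n \<le> c" "1 \<le> d" by (auto simp: B_def)
    then have "real n * 1 \<le> real c * real d" by (intro mult_mono) auto
    then have le: "real n ^ (p - 2) \<le> (real c * real d) ^ (p - 2)"
      by (intro power_mono) auto
    have "f (c, d) = 1 / ((real c * real d) ^ (p - 2) * (real c * real d) ^ 2)"
    proof -
      have "p - 2 + 2 = p" using p by simp
      then have "(real c * real d) ^ p = (real c * real d) ^ (p - 2) * (real c * real d) ^ 2"
        by (metis power_add)
      then show ?thesis by (simp add: f_def)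
    qed
    also have "\<dots> \<le> 1 / (real n ^ (p - 2) * (real c * real d) ^ 2)"
      using le cd n by (intro divide_left_mono mult_right_mono mult_pos_pos zero_less_power) auto
    also have "\<dots> = 1 / real n ^ (p - 2) * ((1 / real c ^ 2) * (1 / real d ^ 2))"
      by (simp add: power_mult_distrib)
    finally show "f (c, d) \<le> 1 / real n ^ (p - 2) * ((1 / real c ^ 2) * (1 / real d ^ 2))" .
  qed
  also have "\<dots> = 1 / real n ^ (p - 2) * ((\<Sum>c=n..N. 1 / real c ^ 2) * (\<Sum>d=1..N. 1 / real d ^ 2))"
    unfolding B_def sum.cartesian_product[symmetric]
    by (subst sum_product) (simp only: sum_distrib_left)
  also have "\<dots> \<le> 1 / real n ^ (p - 2) * ((2 / real n) * 2)"
    using sum_inverse_squares_from[of n N] sum_inverse_squares_from[of 1 N] n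
    by (intro mult_left_mono mult_mono) (auto intro!: sum_nonneg)
  also have "\<dots> = 4 / (real n ^ (p - 2) * real n)" by simp
  also have "real n ^ (p - 2) * real n = real n ^ (p - 1)"
    using p by (simp add: power_Suc2[symmetric] Suc_diff_Suc numeral_2_eq_2)
  finally have "sum f A \<le> 4 / real n ^ (p - 1) + 4 / real n ^ (p - 1)" by linarith
  then show ?thesis by (simp add: f_def)
qed

text \<open>The explicit form of the asymptotics, with error \<open>k^(m + 3/4) + k^(2m - 1)\<close>
  written in powers of \<open>k^(1/4)\<close>.\<close>

lemma dedekind_moment_bound:
  fixes m :: nat
  assumes m: "m > 0" and k: "prime k" "k \<ge> 17"
  defines "K \<equiv> root 4 (real k)"
  shows "\<bar>(\<Sum>h=1..int k - 1. dedekind_sum h k ^ (2 * m))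
      - 2 * (zeta (2 * real m) ^ 2 / zeta (4 * real m)) * (real k / 12) ^ (2 * m)\<bar>
    \<le> 10 ^ 7 * real m * 64 ^ m * (K ^ (4 * m + 3) + K ^ (8 * m - 4))"
proof -
  define p where "p = 2 * m"
  have p: "p \<ge> 2" using m by (simp add: p_def)
  have K: "K \<ge> 1" "K ^ 4 = real k"
    using k by (simp_all add: K_def)
  have sqrtk: "sqrt (real k) = K ^ 2"
  proof (rule real_sqrt_unique)
    show "(K\<^sup>2)\<^sup>2 = real k" using K(2) by (simp add: power_mult[symmetric])
  qed simp
  define X where "X = nat \<lfloor>2 * sqrt (real k)\<rfloor>"
  have XK: "real X \<le> 2 * K ^ 2"
    unfolding X_def sqrtk[symmetric] by simp
  have X1: "X \<ge> 1"
  proof -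
    have "1 \<le> sqrt (real k)" using k by simp
    then have "1 \<le> 2 * sqrt (real k)" by linarith
    then have "1 \<le> \<lfloor>2 * sqrt (real k)\<rfloor>" by (simp add: le_floor_iff)
    then show ?thesis by (simp add: X_def le_nat_iff)
  qed
  have Xk: "X < k"
  proof -
    \<comment> \<open>This gives \<open>X < k\<close>, so the prime \<open>k\<close> is coprime to
      every number in \<open>{1..X}\<close>.\<close>
    have "2 < sqrt (real k)" using k by (intro real_less_rsqrt) auto
    then have "2 * sqrt (real k) < sqrt (real k) * sqrt (real k)"
      using k by (intro mult_strict_right_mono) auto
    then have "2 * sqrt (real k) < real k" by simp
    then have "real X < real k" using XK sqrtk by simp
    then show ?thesis by simp
  qed
  have cop: "coprime k c" if "c \<in> {1..X}" for c
    using that Xk k by (metis atLeastAtMost_iff dvd_imp_le le_less_trans not_le prime_imp_coprime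
        not_one_le_zero gr0I)
  let ?R = "cop_pairs X" and ?Q = "small_pairs k"
  define G where "G = (\<lambda>(c, d). gen_dedekind (int c) (int d) (int k) ^ p)"
  define M where "M = (\<lambda>(c, d). real k / (12 * real c * real d))"
  define E where "E = (\<lambda>(c, d). ded_error k c d)"
  define f where "f = (\<lambda>(c, d). 1 / (real c * real d) ^ p)"
  define \<kappa> where "\<kappa> = (real k / 12) ^ p"
  define Y where "Y = K ^ (4 * m + 3) + K ^ (8 * m - 4)"
  have Y: "K ^ (4 * m + 3) \<le> Y" "Y \<ge> 0" using K by (simp_all add: Y_def)
  note sp = sum_dedekind_powers_small_pairs(1)[OF k(1) X_def Xk]
    sum_dedekind_powers_small_pairs(2)[OF k(1) X_def Xk, of m, folded p_def, folded G_def]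
  have GME: "G x = (M x + E x) ^ p" for x
    by (simp add: G_def M_def E_def ded_error_def split_def)
  have M0: "M x \<ge> 0" for x by (simp add: M_def split_def)
  have Mf: "M x ^ p = \<kappa> * f x" for x
    by (simp add: M_def f_def \<kappa>_def split_def power_divide power_mult_distrib)
  have f0: "f x \<ge> 0" for x by (simp add: f_def split_def)
  have \<kappa>0: "\<kappa> \<ge> 0" by (simp add: \<kappa>_def)
  \<comment> \<open>\<open>A1\<close> and \<open>A2\<close> are the two extremes in expanding
    \<open>(M + E)^p - M^p\<close>, one factor \<open>E\<close> or all of them; up to constants they
    dominate everything between.\<close>
  define A1 where "A1 = (\<Sum>x\<in>?R. M x ^ (p - 1) * \<bar>E x\<bar>)"
  define A2 where "A2 = (\<Sum>x\<in>?R. E x ^ p)"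
  have A1: "A1 \<le> 16 * Y"
    using sum_main_times_error_le[OF m X1 less_imp_le[OF Xk] XK cop K]
    by (simp add: A1_def Y_def M_def E_def p_def split_def)
  have A2: "A2 \<le> 16 ^ m * 50000 * Y"
  proof -
    have "A2 \<le> 16 ^ m * 50000 * K ^ (4 * m + 3)"
      using sum_error_power_le[OF m X1 less_imp_le[OF Xk] XK cop K]
      by (simp add: A2_def E_def p_def split_def)
    also have "\<dots> \<le> 16 ^ m * 50000 * Y" using Y by (intro mult_left_mono) auto
    finally show ?thesis .
  qed
  have evenp: "even p" by (simp add: p_def)
  have 1: "\<bar>G x - M x ^ p\<bar> \<le> real p * 2 ^ p * (M x ^ (p - 1) * \<bar>E x\<bar> + E x ^ p)" for x
  proof -
    have "\<bar>G x - M x ^ p\<bar> \<le> real p * (M x + \<bar>E x\<bar>) ^ (p - 1) * \<bar>E x\<bar>"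
      using power_diff_abs_le[of "M x + E x" "M x + \<bar>E x\<bar>" "M x" p] M0[of x] by (simp add: GME)
    also have "\<dots> \<le> real p * (2 ^ (p - 1) * (M x ^ (p - 1) + \<bar>E x\<bar> ^ (p - 1))) * \<bar>E x\<bar>"
      using M0[of x] by (intro mult_left_mono mult_right_mono power_add_le_sum) auto
    also have "\<dots> \<le> real p * (2 ^ p * (M x ^ (p - 1) + \<bar>E x\<bar> ^ (p - 1))) * \<bar>E x\<bar>"
      using M0[of x] by (intro mult_left_mono mult_right_mono power_increasing) auto
    also have "\<dots> = real p * 2 ^ p * (M x ^ (p - 1) * \<bar>E x\<bar> + \<bar>E x\<bar> ^ (p - 1) * \<bar>E x\<bar>)"
      by (simp add: algebra_simps)
    also have "\<bar>E x\<bar> ^ (p - 1) * \<bar>E x\<bar> = E x ^ p"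
      using p evenp by (simp add: power_Suc2[symmetric] power_even_abs)
    finally show ?thesis .
  qed
  have 2: "G x \<le> 2 ^ p * (M x ^ p + E x ^ p)" for x
  proof -
    have "G x \<le> (M x + \<bar>E x\<bar>) ^ p"
      unfolding GME using M0[of x] evenp
      by (subst power_even_abs[symmetric]) (auto intro!: power_mono)
    also have "\<dots> \<le> 2 ^ p * (M x ^ p + \<bar>E x\<bar> ^ p)"
      using M0[of x] by (intro power_add_le_sum) auto
    finally show ?thesis using evenp by (simp add: power_even_abs)
  qed
  define Z where "Z = zeta (real p) ^ 2 / zeta (real (2 * p))"
  have Z: "(f has_sum Z) all_cop_pairs"
    unfolding f_def Z_def by (rule sum_coprime_pairs_zeta[OF p])
  have Qsub: "?Q \<subseteq> all_cop_pairs" by (auto simp: small_pairs_def all_cop_pairs_def)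
  have Rsub: "?R \<subseteq> all_cop_pairs" by (auto simp: cop_pairs_def all_cop_pairs_def)
  have finQ: "finite ?Q" using sp(1) finite_cop_pairs finite_subset by blast
  \<comment> \<open>The tail \<open>t\<close> serves twice: it completes the sum over small pairs to
    the full series, and it bounds the main terms of the pairs in \<open>?R - ?Q\<close>.\<close>
  define t where "t = Z - sum f ?Q"
  have t: "(f has_sum t) (all_cop_pairs - ?Q)"
    unfolding t_def by (rule has_sum_Diff[OF Z has_sum_finite[OF finQ] Qsub])
  have t_ge: "sum f (?R - ?Q) \<le> t"
    by (rule finite_sum_le_has_sum[OF t]) (use Rsub f0 in auto)
  have tY: "\<kappa> * t \<le> 4 * 4 ^ m * Y"
  proof -
    \<comment> \<open>If \<open>k \<le> 2 * c^2\<close> then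
      \<open>2 * c \<ge> sqrt k = K^2\<close>, whence this threshold. The tail has order
      \<open>K^(- 2 * (p - 1))\<close>, and multiplied by \<open>k^p = K^(4 * p)\<close> it leaves
      \<open>K^(4 * m + 2)\<close>.\<close>
    define n where "n = nat \<lceil>K ^ 2 / 2\<rceil>"
    have n: "real n \<ge> K ^ 2 / 2" "n > 0" using K by (auto simp: n_def)
    have nc: "n \<le> c" if "k \<le> 2 * c ^ 2" for c
    proof -
      have "real k \<le> real (2 * c ^ 2)" using that by (rule of_nat_mono)
      then have "(K ^ 2) ^ 2 \<le> (2 * real c) ^ 2"
        using K(2) by (simp add: power_mult_distrib power_mult[symmetric])
      then have "K ^ 2 \<le> 2 * real c" by (rule power2_le_imp_le) simp
      then show ?thesis by (simp add: n_def nat_le_iff ceiling_le_iff)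
    qed
    have "t \<le> 8 / real n ^ (p - 1)"
    proof (rule has_sum_le_finite_sums[OF t])
      fix F assume "finite F" "F \<subseteq> all_cop_pairs - ?Q"
      then show "sum f F \<le> 8 / real n ^ (p - 1)"
        unfolding f_def using sum_not_small_pairs_le[OF p n(2) nc] by blast
    qed
    also have "\<dots> \<le> 8 / (K ^ 2 / 2) ^ (p - 1)"
      using n K by (intro divide_left_mono power_mono mult_pos_pos zero_less_power) auto
    finally have "t \<le> 8 / (K ^ 2 / 2) ^ (p - 1)" .
    then have "\<kappa> * t \<le> \<kappa> * (8 / (K ^ 2 / 2) ^ (p - 1))"
      using \<kappa>0 by (rule mult_left_mono)
    also have "\<dots> \<le> real k ^ p * (8 / (K ^ 2 / 2) ^ (p - 1))"
    proof (rule mult_right_mono)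
      show "\<kappa> \<le> real k ^ p" unfolding \<kappa>_def by (rule power_mono) auto
    qed (use K in simp)
    also have "\<dots> = 8 * 2 ^ (p - 1) * (K ^ (4 * p) / K ^ (2 * (p - 1)))"
      by (simp add: K(2)[symmetric] power_mult power_divide)
    also have "K ^ (4 * p) / K ^ (2 * (p - 1)) = K ^ (4 * m + 2)"
    proof -
      have "4 * p = (4 * m + 2) + 2 * (p - 1)" using m by (simp add: p_def)
      then have "K ^ (4 * p) = K ^ (4 * m + 2) * K ^ (2 * (p - 1))" by (simp only: power_add)
      then show ?thesis using K by simp
    qed
    also have "8 * 2 ^ (p - 1) = (4 * 4 ^ m :: real)"
    proof -
      have "(2 :: real) ^ p = 2 * 2 ^ (p - 1)" using p by (simp add: power_Suc[symmetric])
      moreover have "(2 :: real) ^ p = 4 ^ m" by (simp add: p_def power_mult)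
      ultimately show ?thesis by simp
    qed
    also have "4 * 4 ^ m * K ^ (4 * m + 2) \<le> 4 * 4 ^ m * Y"
    proof (intro mult_left_mono order_trans[OF _ Y(1)] power_increasing)
    qed (use K in auto)
    finally show ?thesis .
  qed
  have E0: "E x ^ p \<ge> 0" for x using evenp by (simp add: zero_le_even_power)
  have B1: "\<bar>sum G ?Q - \<kappa> * sum f ?Q\<bar> \<le> real p * 2 ^ p * (A1 + A2)"
  proof -
    have "\<bar>sum G ?Q - \<kappa> * sum f ?Q\<bar> = \<bar>\<Sum>x\<in>?Q. G x - M x ^ p\<bar>"
      by (simp add: Mf sum_subtractf sum_distrib_left)
    also have "\<dots> \<le> (\<Sum>x\<in>?Q. real p * 2 ^ p * (M x ^ (p - 1) * \<bar>E x\<bar> + E x ^ p))"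
      by (intro order_trans[OF sum_abs] sum_mono 1)
    also have "\<dots> \<le> (\<Sum>x\<in>?R. real p * 2 ^ p * (M x ^ (p - 1) * \<bar>E x\<bar> + E x ^ p))"
      using sp(1) M0 E0 by (intro sum_mono2) auto
    also have "\<dots> = real p * 2 ^ p * (A1 + A2)"
      by (simp add: A1_def A2_def sum_distrib_left[symmetric] sum.distrib)
    finally show ?thesis .
  qed
  have B2: "sum G (?R - ?Q) \<le> 2 ^ p * (\<kappa> * t + A2)"
  proof -
    have "sum G (?R - ?Q) \<le> (\<Sum>x\<in>?R - ?Q. 2 ^ p * (\<kappa> * f x + E x ^ p))"
      using 2 by (intro sum_mono) (simp add: Mf)
    also have "\<dots> = 2 ^ p * (\<kappa> * sum f (?R - ?Q) + (\<Sum>x\<in>?R - ?Q. E x ^ p))"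
      by (simp add: sum_distrib_left[symmetric] sum.distrib)
    also have "\<dots> \<le> 2 ^ p * (\<kappa> * t + A2)"
      unfolding A2_def using t_ge \<kappa>0 E0 by (intro mult_left_mono add_mono sum_mono2) auto
    finally show ?thesis .
  qed
  have t0: "\<kappa> * t \<ge> 0"
    using \<kappa>0 t_ge sum_nonneg[of "?R - ?Q" f] f0 by (intro mult_nonneg_nonneg) (auto intro: order_trans)
  define S where "S = (\<Sum>h=1..int k - 1. dedekind_sum h k ^ p)"
  \<comment> \<open>The three errors come from residues not represented by small pairs
    (\<open>B2\<close>), from replacing \<open>G\<close> by \<open>M^p\<close> on small pairs
    (\<open>B1\<close>), and from completing the series (\<open>t\<close>).\<close>
  have "\<bar>S - 2 * Z * \<kappa>\<bar> \<le> 2 * (2 ^ p * (\<kappa> * t + A2)) + 2 * (real p * 2 ^ p * (A1 + A2)) + 2 * (\<kappa> * t)"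
  proof -
    have "\<bar>S - 2 * sum G ?Q\<bar> \<le> 2 * sum G (?R - ?Q)" using sp(2) by (simp add: S_def)
    moreover have "2 * Z * \<kappa> = 2 * (\<kappa> * sum f ?Q) + 2 * (\<kappa> * t)"
      by (simp add: t_def algebra_simps)
    ultimately show ?thesis using B1 B2 t0 by linarith
  qed
  also have "\<dots> \<le> 2 * (4 ^ m * (4 * 4 ^ m * Y + 16 ^ m * 50000 * Y))
      + 2 * (2 * real m * 4 ^ m * (16 * Y + 16 ^ m * 50000 * Y)) + 2 * (4 * 4 ^ m * Y)"
  proof -
    have "(2 :: real) ^ p = 4 ^ m" "real p = 2 * real m" by (simp_all add: p_def power_mult)
    then show ?thesis
      using tY A1 A2 by (simp only:) (intro add_mono mult_left_mono; simp)
  qed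
  also have "\<dots> \<le> 10 ^ 7 * real m * 64 ^ m * Y"
  proof -
    \<comment> \<open>All mixed powers of 4 and 16 are at most \<open>64^m\<close>; the numerical
      coefficients add up to 300080, below \<open>10^7\<close>.\<close>
    have "(4 :: real) ^ m * 4 ^ m \<le> 64 ^ m" "(4 :: real) ^ m * 16 ^ m = 64 ^ m" "(4 :: real) ^ m \<le> 64 ^ m"
      by (simp_all add: power_mult_distrib[symmetric] power_mono)
    moreover have "(64 :: real) ^ m \<le> real m * 64 ^ m" "real m * 4 ^ m \<le> real m * 64 ^ m"
      using m by (simp_all add: power_mono)
    moreover define u v w z where "u = (4 :: real) ^ m * 4 ^ m" and "v = (64 :: real) ^ m"
      and "w = (4 :: real) ^ m" and "z = real m * 64 ^ m"
    ultimately have *: "u \<le> v" "(4 :: real) ^ m * 16 ^ m = v" "w \<le> v" "v \<le> z" "real m * w \<le> z" "v \<ge> 0" by simp_all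
    have "2 * (4 ^ m * (4 * 4 ^ m * Y + 16 ^ m * 50000 * Y))
      + 2 * (2 * real m * 4 ^ m * (16 * Y + 16 ^ m * 50000 * Y)) + 2 * (4 * 4 ^ m * Y)
      = (8 * u + 100000 * (4 ^ m * 16 ^ m) + 64 * (real m * w) + 200000 * (real m * (4 ^ m * 16 ^ m)) + 8 * w) * Y"
      unfolding u_def w_def by (simp add: algebra_simps)
    also have "\<dots> \<le> (10 ^ 7 * z) * Y"
    proof (rule mult_right_mono)
      have "real m * (4 ^ m * 16 ^ m) = z" using *(2) by (simp add: z_def v_def)
      then show "8 * u + 100000 * (4 ^ m * 16 ^ m) + 64 * (real m * w) + 200000 * (real m * (4 ^ m * 16 ^ m)) + 8 * w
          \<le> 10 ^ 7 * z"
        using *(1,3-6) by (simp add: *(2))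
    qed (rule Y)
    finally show ?thesis by (simp add: z_def mult.assoc)
  qed
  finally show ?thesis
    by (simp add: S_def Z_def \<kappa>_def Y_def p_def)
qed

theorem theorem1:
  fixes m :: nat
  assumes "m > 0"
  shows "(\<lambda>k::nat. (\<Sum>h=1..int k - 1. dedekind_sum h k ^ (2 * m))
            - 2 * (zeta (2 * real m) ^ 2 / zeta (4 * real m)) * (real k / 12) ^ (2 * m))
         \<in> O[inf at_top (principal {k. prime k})](\<lambda>k.
             (real k powr (9 / 5) + real k powr (2 * real m - 1 + 1 / (real m + 1)))
                    * ln (real k) ^ 3)"
proof (rule bigoI[where c = "2 * (10 ^ 7 * real m * 64 ^ m)"])
  define W where "W k = real k powr (9 / 5) + real k powr (2 * real m - 1 + 1 / (real m + 1))" for k :: nat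
  have main: "norm ((\<Sum>h=1..int k - 1. dedekind_sum h k ^ (2 * m))
            - 2 * (zeta (2 * real m) ^ 2 / zeta (4 * real m)) * (real k / 12) ^ (2 * m))
          \<le> 2 * (10 ^ 7 * real m * 64 ^ m) * norm (W k * ln (real k) ^ 3)"
    if k: "prime k" "k \<ge> 17" for k
  proof -
    define K where "K = root 4 (real k)"
    have k1: "real k \<ge> 17" using k by simp
    have Kpow: "K ^ n = real k powr (real n / 4)" for n
    proof -
      have "K = real k powr (1 / 4)"
        using k1 by (simp add: K_def root_powr_inverse)
      then have "K ^ n = (real k powr (1 / 4)) powr real n"
        using k1 by (simp add: powr_realpow)
      then show ?thesis by (simp add: powr_powr)
    qed
    \<comment> \<open>\<open>q\<close> is whichever target power absorbs both error powers,
      \<open>r\<close> the other one.\<close>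
    have *: "x + y \<le> 2 * (q + r)" if "x \<le> q" "y \<le> q" "r \<ge> 0" for x y q r :: real
      by (rule order_trans[OF add_mono[OF that(1,2)]]) (use that(3) in simp)
    have "K ^ (4 * m + 3) + K ^ (8 * m - 4) \<le> 2 * W k"
    proof (cases "m = 1")
      \<comment> \<open>For \<open>m = 1\<close> the exponents 7/4 and 1 are below 9/5.\<close>
      case True
      have "K ^ (4 * m + 3) \<le> real k powr (9 / 5)" "K ^ (8 * m - 4) \<le> real k powr (9 / 5)"
        unfolding Kpow using k1 True powr_mono[of "7 / 4" "9 / 5" "real k"] powr_mono[of 1 "9 / 5" "real k"]
        by simp_all
      then show ?thesis unfolding W_def by (rule *) (rule powr_ge_zero)
    next
      case False
      then have m2: "real m \<ge> 2" using assms by simp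
      \<comment> \<open>For \<open>m \<ge> 2\<close> also \<open>m + 3/4 \<le> 2 * m - 1\<close>, so
        both powers fit under the second target.\<close>
      have e: "real (4 * m + 3) / 4 \<le> 2 * real m - 1 + 1 / (real m + 1)"
        "real (8 * m - 4) / 4 \<le> 2 * real m - 1 + 1 / (real m + 1)"
      proof -
        define q where "q = 1 / (real m + 1)"
        have "q \<ge> 0" by (simp add: q_def)
        moreover have "real (8 * m - 4) = 8 * real m - 4" using assms by (simp add: of_nat_diff)
        ultimately show "real (4 * m + 3) / 4 \<le> 2 * real m - 1 + 1 / (real m + 1)"
          "real (8 * m - 4) / 4 \<le> 2 * real m - 1 + 1 / (real m + 1)"
          unfolding q_def[symmetric] using m2 by simp_all
      qed
      have "K ^ (4 * m + 3) \<le> real k powr (2 * real m - 1 + 1 / (real m + 1))"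
        "K ^ (8 * m - 4) \<le> real k powr (2 * real m - 1 + 1 / (real m + 1))"
        unfolding Kpow using k1 by (intro powr_mono e; simp)+
      then show ?thesis unfolding W_def add.commute[of "real k powr (9 / 5)"] by (rule *) (rule powr_ge_zero)
    qed
    also have "\<dots> \<le> 2 * (W k * ln (real k) ^ 3)"
    proof -
      \<comment> \<open>Hence the cube of the logarithm only enlarges the bound.\<close>
      have "1 \<le> ln (real k)"
      proof -
        have "exp 1 \<le> real k" using exp_le k1 by linarith
        then show ?thesis using k1 by (simp add: ln_ge_iff)
      qed
      then have "W k * 1 \<le> W k * ln (real k) ^ 3"
        by (intro mult_left_mono one_le_power) (auto simp: W_def)
      then show ?thesis by simp
    qed
    finally have "10 ^ 7 * real m * 64 ^ m * (K ^ (4 * m + 3) + K ^ (8 * m - 4))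
        \<le> 10 ^ 7 * real m * 64 ^ m * (2 * (W k * ln (real k) ^ 3))"
      by (intro mult_left_mono) auto
    also have "\<dots> \<le> 2 * (10 ^ 7 * real m * 64 ^ m) * norm (W k * ln (real k) ^ 3)"
    proof -
      have "10 ^ 7 * real m * 64 ^ m * (2 * w) \<le> 2 * (10 ^ 7 * real m * 64 ^ m) * norm w" for w :: real
        using mult_left_mono[OF abs_ge_self[of w], of "2 * (10 ^ 7 * real m * 64 ^ m)"] by simp
      then show ?thesis .
    qed
    finally show ?thesis
      using dedekind_moment_bound[OF assms k] unfolding K_def by simp
  qed
  show "\<forall>\<^sub>F k in inf at_top (principal {k. prime k}).
      norm ((\<Sum>h=1..int k - 1. dedekind_sum h k ^ (2 * m))
            - 2 * (zeta (2 * real m) ^ 2 / zeta (4 * real m)) * (real k / 12) ^ (2 * m))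
      \<le> 2 * (10 ^ 7 * real m * 64 ^ m) * norm ((real k powr (9 / 5) + real k powr (2 * real m - 1 + 1 / (real m + 1)))
                    * ln (real k) ^ 3)"
    \<comment> \<open>On this filter a property has to hold for all sufficiently large
      \<open>k\<close> that are prime.\<close>
    unfolding eventually_inf_principal
    using eventually_ge_at_top[of "17 :: nat"] by eventually_elim (use main in \<open>auto simp: W_def\<close>)
qed

end
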